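(* Let $G$ be an infinite, connected, vertex-transitive, $d$-regular directed graph (with symmetric edge set). Let $$c({\bf p},d)=\sum_{i=1}^d p_i\frac{i}{d},\qquad \tilde c({\bf p},d)=\frac{1}{d^2}\left(\sum_{i=1}^d p_i\frac{i}{d}\right)\left(\sum_{i=2}^d p_i\frac{i(i-1)}{d(d-1)}\right).$$ (i) Suppose $\chi(G,{\bf p})<\infty$. Then $$P_{\bf p}(|C|\ge n)\le e^{-n\frac{c({\bf p},d)^2}{2\chi(G,{\bf p})^2}}\qquad\text{for } n>\frac{\chi(G,{\bf p})^2}{c({\bf p},d)^2}.$$ (ii) Suppose $\tilde\chi(G,{\bf p})<\infty$. Then $$P_{\bf p}(|\tilde C|\ge n)\le e^{-n\frac{\tilde c({\bf p},d)^2}{2\tilde\chi(G,{\bf p})^2}}\qquad\text{for } n>\frac{\tilde\chi(G,{\bf p})^2}{\tilde c({\bf p},d)^2}.$$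
   Context: $G=(V,E,o)$ is an infinite simple directed graph with origin $o\in V$: $V$ is countably infinite, $E\subset V\times V\setminus\{(x,x)\}$, and $(x,y)\in E$ iff $(y,x)\in E$; $x\sim y$ means $(x,y)\in E$; $L_x=\{y:(x,y)\in E\}$. $G$ is $d$-regular ($|L_x|=d$ for all $x$), connected with respect to $\sim$, and vertex-transitive (automorphisms act transitively on $V$). Let ${\bf p}=(p_0,\dots,p_d)$ with $p_i\ge0$ and $\sum_i p_i=1$. Configurations are $\omega\in\Omega=\prod_{x\in V}2^{L_x}$ with the $\sigma$-field generated by finite-dimensional cylinders; $P_{\bf p}$ is the product measure under which the states $\omega(x)\subset L_x$ are independent with $P_{\bf p}(\omega(x)=S)=p_{|S|}/\binom{d}{|S|}$ for $S\subset L_x$. Put $E_\omega=\{(x,y):x\in V,\ y\in\omega(x)\}$. Vertices $x,y$ are weakly connected if $x=y$ or there are $x=z_0,\dots,z_m=y$ such that for each $i$, $(z_i,z_{i+1})\in E_\omega$ or $(z_{i+1},z_i)\in E_\omega$; strongly connected if $x=y$ or there is such a sequence with both $(z_i,z_{i+1})\in E_\omega$ and $(z_{i+1},z_i)\in E_\omega$ for each $i$. $|C|$ (resp. $|\tilde C|$) is the number of vertices weakly (resp. strongly) connected to $o$; $\chi(G,{\bf p})=\mathbb{E}_{\bf p}(|C|)$ and $\tilde\chi(G,{\bf p})=\mathbb{E}_{\bf p}(|\tilde C|)$. Here $n$ is a positive integer. *)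

theory Defs
  imports "HOL-Probability.Probability" "Graph_Theory.Digraph_Isomorphism"
begin

abbreviation nbrs :: "'v pair_pre_digraph \<Rightarrow> 'v \<Rightarrow> 'v set" where
  "nbrs G x \<equiv> {y. (x, y) \<in> parcs G}"

text \<open>An automorphism is an isomorphism of the graph onto itself.\<close>

definition vertex_transitive :: "'v pair_pre_digraph \<Rightarrow> bool" where
  "vertex_transitive G \<longleftrightarrow>
     (\<forall>x\<in>pverts G. \<forall>y\<in>pverts G. \<exists>f.
        pre_digraph.digraph_isomorphism (with_proj G) f \<and>
        app_iso f (with_proj G) = with_proj G \<and>
        iso_verts f x = y)"

text \<open>
  The finiteness clause is needed because \<open>card\<close> of an infinite set is 0.
  The qualified \<open>Digraph_Component.connected\<close> avoids topological connectedness.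
\<close>

locale transitive_regular_digraph = pair_bidirected_digraph G
  for G :: "'v pair_pre_digraph" +
  fixes root :: 'v and d :: nat
  assumes root_in_verts: "root \<in> pverts G"
    and countable_verts: "countable (pverts G)"
    and infinite_verts: "infinite (pverts G)"
    and regular: "\<And>x. x \<in> pverts G \<Longrightarrow> finite (nbrs G x) \<and> card (nbrs G x) = d"
    and connected: "Digraph_Component.connected (with_proj G)"
    and transitive: "vertex_transitive G"

text \<open>
  A configuration assigns to each vertex \<open>x\<close> a subset of \<open>nbrs G x\<close>; the states are
  independent, and \<open>S\<close> has probability \<open>p (card S) / (d choose card S)\<close>.
\<close>

definition perc :: "'v pair_pre_digraph \<Rightarrow> nat \<Rightarrow> (nat \<Rightarrow> real) \<Rightarrow> ('v \<Rightarrow> 'v set) measure" where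
  "perc G d p =
     (\<Pi>\<^sub>M x\<in>pverts G. point_measure (Pow (nbrs G x))
        (\<lambda>S. ennreal (p (card S) / real (d choose card S))))"

definition open_arcs :: "'v pair_pre_digraph \<Rightarrow> ('v \<Rightarrow> 'v set) \<Rightarrow> 'v rel" where
  "open_arcs G \<omega> = {(x, y). x \<in> pverts G \<and> y \<in> \<omega> x}"

definition weak_cluster :: "'v pair_pre_digraph \<Rightarrow> 'v \<Rightarrow> ('v \<Rightarrow> 'v set) \<Rightarrow> 'v set" where
  "weak_cluster G x \<omega> =
     {y \<in> pverts G. (x, y) \<in> (open_arcs G \<omega> \<union> (open_arcs G \<omega>)\<inverse>)\<^sup>*}"

text \<open>
  Strong connection requires each single step to be open in both directions; it is not
  mutual reachability along directed paths.
\<close>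

definition strong_cluster :: "'v pair_pre_digraph \<Rightarrow> 'v \<Rightarrow> ('v \<Rightarrow> 'v set) \<Rightarrow> 'v set" where
  "strong_cluster G x \<omega> =
     {y \<in> pverts G. (x, y) \<in> (open_arcs G \<omega> \<inter> (open_arcs G \<omega>)\<inverse>)\<^sup>*}"

text \<open>Number of elements, with value \<open>\<infinity>\<close> for infinite sets.\<close>

abbreviation num :: "'v set \<Rightarrow> ennreal" where
  "num A \<equiv> emeasure (count_space UNIV) A"

definition weak_chi :: "'v pair_pre_digraph \<Rightarrow> 'v \<Rightarrow> nat \<Rightarrow> (nat \<Rightarrow> real) \<Rightarrow> ennreal" where
  "weak_chi G x d p = (\<integral>\<^sup>+\<omega>. num (weak_cluster G x \<omega>) \<partial>perc G d p)"

definition strong_chi :: "'v pair_pre_digraph \<Rightarrow> 'v \<Rightarrow> nat \<Rightarrow> (nat \<Rightarrow> real) \<Rightarrow> ennreal" where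
  "strong_chi G x d p = (\<integral>\<^sup>+\<omega>. num (strong_cluster G x \<omega>) \<partial>perc G d p)"

definition weak_c :: "(nat \<Rightarrow> real) \<Rightarrow> nat \<Rightarrow> real" where
  "weak_c p d = (\<Sum>i=1..d. p i * (real i / real d))"

definition strong_c :: "(nat \<Rightarrow> real) \<Rightarrow> nat \<Rightarrow> real" where
  "strong_c p d = 1 / (real d)^2 *
     (\<Sum>i=1..d. p i * (real i / real d)) *
     (\<Sum>i=2..d. p i * (real i * (real i - 1) / (real d * (real d - 1))))"

end

theory Submission
  imports Defs
begin

text \<open>
  If \<open>o\<close> is connected to \<open>y\<^sub>1, \<dots>, y\<^sub>k\<close>, then the open graph contains a binary tree with these leaves.
  Let a path of the tree starting at the vertex \<open>w\<close> use the states of its vertices other than \<open>w\<close>. Then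
  distinct paths use disjoint sets of states, and Reimer's inequality bounds the probability of the
  tree by a product over its paths. Not using the state of \<open>w\<close> costs a factor \<open>1 / c\<close> per path, since
  the first step can be opened by resampling that state. Summing over the inner vertices of the tree and
  over the leaves gives \<open>E |C|\<^sup>k \<le> a\<^sub>k\<close>, where \<open>B = \<chi> / c\<close>, \<open>a\<^sub>1 = B\<close> and
  \<open>a\<^sub>k = (B / 2) \<Sum>\<^sub>j (k choose j) a\<^sub>j a\<^sub>k\<^sub>-\<^sub>j\<close>. At \<open>t = 1 / (2 B\<^sup>2)\<close> the series \<open>\<Sum>\<^sub>k a\<^sub>k t\<^sup>k / k!\<close>
  is at most \<open>1 / B\<close>, so Markov's inequality for \<open>exp (t |C|) - 1\<close> gives
  \<open>P (|C| \<ge> n) \<le> (1 / B) / (exp (n t) - 1)\<close>. This is at most \<open>exp (- n t)\<close> for \<open>n > B\<^sup>2\<close> since \<open>B \<ge> 3\<close>: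
  the degree is at least 2, hence \<open>\<chi> \<ge> 1 + 2 c\<close> in the weak case and \<open>c \<le> 1 / 4\<close> in the strong case.
\<close>

section \<open>Reimer's inequality\<close>

text \<open>The independent units are whole states, and disjointness has to be counted by vertices;
  Reimer's inequality covers arbitrary events of such variables. Three paths meet at a branching
  vertex and only one of them may use its state: hence the convention about start vertices. The
  exponent comes from the generating function F = \<Sum> a_k t^k / k!, which solves F = B t + (B /
  2) F^2. Its singularity is at t = 1 / (2 B^2), where F = 1 / B, so this is the largest usable t.
  Reimer's inequality is applied in finite volumes. These are not invariant under automorphisms, so
  the bound by \<chi> is proved for all of them at once, and the graph is exhausted only at the
  end.\<close>

lemma homogeneous_system_solution:
  fixes a :: "'a \<Rightarrow> 'b \<Rightarrow> int"
  assumes "finite Z" "finite X" "card Z < card X"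
  obtains c where "\<exists>x\<in>X. c x \<noteq> 0" "\<And>z. z \<in> Z \<Longrightarrow> (\<Sum>x\<in>X. c x * a x z) = 0"
proof -
  have "\<exists>c. (\<exists>x\<in>X. c x \<noteq> 0) \<and> (\<forall>z\<in>Z. (\<Sum>x\<in>X. c x * a x z) = 0)"
    using assms
  proof (induction Z arbitrary: X a rule: finite_induct)
    case empty
    then have "X \<noteq> {}" by auto
    then show ?case by (intro exI[of _ "\<lambda>_. 1"]) auto
  next
    case (insert z Z)
    show ?case
    proof (cases "\<forall>x\<in>X. a x z = 0")
      case True
      from insert.IH[of X a] insert.prems insert.hyps obtain c
        where "\<exists>x\<in>X. c x \<noteq> 0" "\<forall>z\<in>Z. (\<Sum>x\<in>X. c x * a x z) = 0" by auto
      with True show ?thesis by (intro exI[of _ c]) auto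
    next
      case False
      then obtain x0 where x0: "x0 \<in> X" "a x0 z \<noteq> 0" by blast
      \<comment> \<open>Cross-multiplication with the pivot \<open>a x0 z\<close> eliminates
        \<open>x0\<close> without dividing: the solution has to stay integral for a later argument
        modulo 2.\<close>
      define a' where "a' x y = a x0 z * a x y - a x z * a x0 y" for x y
      have "card Z < card (X - {x0})"
        using insert.prems insert.hyps x0 by auto
      with insert.IH[of "X - {x0}" a'] insert.prems obtain c
        where c: "\<exists>x\<in>X-{x0}. c x \<noteq> 0" "\<forall>y\<in>Z. (\<Sum>x\<in>X-{x0}. c x * a' x y) = 0" by auto
      define e where
        "e x = (if x = x0 then - (\<Sum>y\<in>X-{x0}. c y * a y z) else a x0 z * c x)" for x
      have split: "(\<Sum>x\<in>X. e x * a x y) = (\<Sum>x\<in>X-{x0}. c x * a' x y)" for y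
      proof -
        have "(\<Sum>x\<in>X. e x * a x y) = e x0 * a x0 y + (\<Sum>x\<in>X-{x0}. e x * a x y)"
          using insert.prems x0 by (intro sum.remove) auto
        also have "(\<Sum>x\<in>X-{x0}. e x * a x y) = (\<Sum>x\<in>X-{x0}. a x0 z * c x * a x y)"
          by (intro sum.cong) (auto simp: e_def)
        also have "e x0 * a x0 y + \<dots> = (\<Sum>x\<in>X-{x0}. c x * a' x y)"
          by (simp add: e_def a'_def sum_distrib_left sum_distrib_right sum_subtractf algebra_simps)
        finally show ?thesis .
      qed
      have "\<exists>x\<in>X. e x \<noteq> 0" using c(1) x0 by (auto simp: e_def)
      moreover have "(\<Sum>x\<in>X. e x * a x z) = 0"
        unfolding split by (simp add: a'_def)
      ultimately show ?thesis using c(2) split by (intro exI[of _ e]) auto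
    qed
  qed
  then show thesis using that by blast
qed

text \<open>Infinite descent: modulo 2 the matrix is the identity, so equation \<open>z\<close>
  forces \<open>c z\<close> to be even, and halving a nonzero solution gives one of smaller total
  absolute value.\<close>

lemma odd_diagonal_imp_zero:
  fixes m :: "'a \<Rightarrow> 'a \<Rightarrow> int"
  assumes "finite X"
    and diag: "\<And>x. x \<in> X \<Longrightarrow> odd (m x x)"
    and off: "\<And>x z. x \<in> X \<Longrightarrow> z \<in> X \<Longrightarrow> x \<noteq> z \<Longrightarrow> even (m x z)"
    and "\<And>z. z \<in> X \<Longrightarrow> (\<Sum>x\<in>X. c x * m x z) = 0"
  shows "\<forall>x\<in>X. c x = 0"
  using assms(4)
proof (induction "\<Sum>x\<in>X. nat \<bar>c x\<bar>" arbitrary: c rule: less_induct)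
  case less
  have even: "even (c z)" if "z \<in> X" for z
  proof -
    have "(\<Sum>x\<in>X. c x * m x z) = c z * m z z + (\<Sum>x\<in>X-{z}. c x * m x z)"
      using \<open>finite X\<close> that by (intro sum.remove) auto
    moreover have "even (\<Sum>x\<in>X-{z}. c x * m x z)"
      using that by (intro dvd_sum) (auto simp: off)
    ultimately have "even (c z * m z z)"
      using less.prems[OF that] by (metis even_add even_zero)
    then show ?thesis using diag[OF that] by simp
  qed
  show ?case
  proof (rule ccontr)
    assume "\<not> ?thesis"
    then obtain x0 where x0: "x0 \<in> X" "c x0 \<noteq> 0" by blast
    define e where "e x = c x div 2" for x
    have ce: "c x = 2 * e x" if "x \<in> X" for x using even[OF that] by (simp add: e_def)
    have "(\<Sum>x\<in>X. nat \<bar>e x\<bar>) < (\<Sum>x\<in>X. nat \<bar>c x\<bar>)"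
      using \<open>finite X\<close> x0 by (intro sum_strict_mono_ex1) (auto simp: ce intro!: bexI[of _ x0])
    moreover have "(\<Sum>x\<in>X. e x * m x z) = 0" if "z \<in> X" for z
    proof -
      have "2 * (\<Sum>x\<in>X. e x * m x z) = (\<Sum>x\<in>X. c x * m x z)"
        unfolding sum_distrib_left by (intro sum.cong) (auto simp: ce)
      then show ?thesis using less.prems[OF that] by simp
    qed
    ultimately have "\<forall>x\<in>X. e x = 0" by (rule less.hyps)
    with x0 ce show False by auto
  qed
qed

text \<open>The tensor power of the matrix with rows (2, -1) and (-1, 2). This matrix sends (1, 2)
  to (0, 3) and (2, 1) to (3, 0), so that it makes the two bases used below dual to each other, up
  to a swap and the factor 3.\<close>

definition cube_form :: "'a set \<Rightarrow> 'a set \<Rightarrow> 'a set \<Rightarrow> int" where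
  "cube_form I b z = (\<Prod>i\<in>I. if i \<in> b \<longleftrightarrow> i \<in> z then 2 else - 1)"

lemma sum_Pow_insert:
  assumes "finite I" "i \<notin> I"
  shows "(\<Sum>b\<in>Pow (insert i I). g b) = (\<Sum>b\<in>Pow I. g b + g (insert i b) :: 'b :: comm_monoid_add)"
proof -
  have "(\<Sum>b\<in>Pow (insert i I). g b) = (\<Sum>b\<in>Pow I. g b) + (\<Sum>b\<in>insert i ` Pow I. g b)"
    unfolding Pow_insert using assms by (intro sum.union_disjoint) auto
  also have "(\<Sum>b\<in>insert i ` Pow I. g b) = (\<Sum>b\<in>Pow I. g (insert i b))"
    using assms by (subst sum.reindex) (auto simp: inj_on_def dest: insert_ident)
  finally show ?thesis by (simp add: sum.distrib)
qed

text \<open>One coordinate splits off through 2 a^2 - 2 a b + 2 b^2 = a^2 + b^2 + (a - b)^2: the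
  form is the sum of the forms of the two halves of \<open>u\<close> and of their difference. The
  lower bound by squares, not mere nonnegativity, is what yields definiteness.\<close>

lemma cube_form_ge:
  assumes "finite I"
  shows "(\<Sum>b\<in>Pow I. \<Sum>z\<in>Pow I. u b * u z * cube_form I b z) \<ge> (\<Sum>b\<in>Pow I. (u b)\<^sup>2)"
  using assms
proof (induction I arbitrary: u rule: finite_induct)
  case empty
  show ?case by (simp add: cube_form_def power2_eq_square)
next
  case (insert i I)
  define Q where "Q u = (\<Sum>b\<in>Pow I. \<Sum>z\<in>Pow I. u b * u z * cube_form I b z)" for u
  have nn: "Q w \<ge> 0" for w
    using insert.IH[of w] unfolding Q_def by (smt (verit) sum_nonneg zero_le_power2)
  let ?v = "\<lambda>b. u (insert i b)"
  have [simp]: "cube_form (insert i I) b z = 2 * cube_form I b z"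
    "cube_form (insert i I) (insert i b) z = - cube_form I b z"
    "cube_form (insert i I) b (insert i z) = - cube_form I b z"
    "cube_form (insert i I) (insert i b) (insert i z) = 2 * cube_form I b z"
    if "b \<in> Pow I" "z \<in> Pow I" for b z
    using that insert.hyps by (auto simp: cube_form_def intro!: prod.cong)
  have "(\<Sum>b\<in>Pow (insert i I). \<Sum>z\<in>Pow (insert i I). u b * u z * cube_form (insert i I) b z)
      = (\<Sum>b\<in>Pow I. \<Sum>z\<in>Pow I. u b * u z * cube_form I b z + ?v b * ?v z * cube_form I b z
           + (u b - ?v b) * (u z - ?v z) * cube_form I b z)"
    unfolding sum_Pow_insert[OF insert.hyps] sum.distrib[symmetric]
    by (intro sum.cong refl) (simp add: algebra_simps)
  also have "\<dots> = Q u + Q ?v + Q (\<lambda>b. u b - ?v b)"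
    by (simp add: Q_def sum.distrib)
  also have "\<dots> \<ge> (\<Sum>b\<in>Pow I. (u b)\<^sup>2) + (\<Sum>b\<in>Pow I. (?v b)\<^sup>2)"
    using insert.IH[of u] insert.IH[of ?v] nn[of "\<lambda>b. u b - ?v b"] by (simp add: Q_def)
  finally show ?case
    by (simp add: sum_Pow_insert[OF insert.hyps] sum.distrib)
qed

text \<open>
  For each coordinate the vectors \<open>(1, 0)\<close>, \<open>(0, 1)\<close> and \<open>(1, 2)\<close>, \<open>(2, 1)\<close> form two bases of the plane.
  The tensor products with factors from the first basis on \<open>K x\<close> and from the second one elsewhere
  are linearly independent, since their matrix is the identity modulo 2. If there were more of them
  than points \<open>y \<in> A\<close> with \<open>I - y \<in> B\<close>, some nontrivial combination \<open>u\<close> would vanish at all these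
  points. The form with matrix \<open>(2, -1; -1, 2)\<close> in each coordinate is positive definite, and \<open>u\<close> would
  be isotropic for it.
\<close>

lemma reimer_cube:
  fixes K :: "'a set \<Rightarrow> 'a set"
  assumes fin: "finite I" and X: "X \<subseteq> Pow I"
    and A: "\<And>x y. x \<in> X \<Longrightarrow> y \<subseteq> I \<Longrightarrow> (\<And>i. i \<in> I \<inter> K x \<Longrightarrow> i \<in> y \<longleftrightarrow> i \<in> x) \<Longrightarrow> y \<in> A"
    and B: "\<And>x y. x \<in> X \<Longrightarrow> y \<subseteq> I \<Longrightarrow> (\<And>i. i \<in> I - K x \<Longrightarrow> i \<in> y \<longleftrightarrow> i \<in> x) \<Longrightarrow> y \<in> B"
  shows "card X \<le> card {y \<in> Pow I. y \<in> A \<and> I - y \<in> B}"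
proof (rule ccontr)
  define G where "G = {y \<in> Pow I. y \<in> A \<and> I - y \<in> B}"
  define m :: "'a set \<Rightarrow> 'a set \<Rightarrow> int" where
    "m x z = (\<Prod>i\<in>I. if i \<in> x \<longleftrightarrow> i \<in> z then 1 else if i \<in> K x then 0 else 2)" for x z
  assume "\<not> card X \<le> card {y \<in> Pow I. y \<in> A \<and> I - y \<in> B}"
  then have "card G < card X" by (simp add: G_def)
  moreover have finX: "finite X" and finG: "finite G"
    using fin X finite_subset[of X "Pow I"] by (auto simp: G_def)
  ultimately obtain c where c: "\<exists>x\<in>X. c x \<noteq> 0" "\<And>z. z \<in> G \<Longrightarrow> (\<Sum>x\<in>X. c x * m x z) = 0"
    using homogeneous_system_solution[of G X m] by blast
  define u where "u z = (\<Sum>x\<in>X. c x * m x z)" for z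
  have uA: "z \<in> A" if "u z \<noteq> 0" "z \<in> Pow I" for z
  proof -
    have "\<exists>x\<in>X. m x z \<noteq> 0"
      using that(1) unfolding u_def by (auto intro: ccontr)
    then obtain x where x: "x \<in> X" "m x z \<noteq> 0" by blast
    then have "\<forall>i\<in>I. i \<in> K x \<longrightarrow> (i \<in> z \<longleftrightarrow> i \<in> x)"
      using fin by (auto simp: m_def split: if_splits)
    then show ?thesis using that x by (intro A[of x]) auto
  qed
  have orth: "(\<Sum>z\<in>Pow I. cube_form I b z * m x z) = 0"
    if b: "b \<in> Pow I" "I - b \<notin> B" and x: "x \<in> X" for b x
  proof -
    \<comment> \<open>If \<open>b\<close> and \<open>x\<close> differed everywhere off
      \<open>K x\<close>, then \<open>I - b\<close> would agree with \<open>x\<close> there and lie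
      in \<open>B\<close>. So they agree at some such \<open>i\<close>, whose factor below is 2 * 1
      + (-1) * 2 = 0.\<close>
    obtain i where i: "i \<in> I" "i \<notin> K x" "i \<in> b \<longleftrightarrow> i \<in> x"
      using B[of x "I - b"] b x by auto
    let ?f = "\<lambda>i t. (if (i \<in> b) = t then 2 else - 1) *
                (if (i \<in> x) = t then 1 else if i \<in> K x then 0 else 2 :: int)"
    have "(\<Sum>z\<in>Pow I. cube_form I b z * m x z)
       = (\<Sum>z\<in>Pow I. (\<Prod>i\<in>z. ?f i True) * (\<Prod>i\<in>I-z. ?f i False))"
    proof (intro sum.cong refl)
      fix z assume "z \<in> Pow I"
      then have "(\<Prod>i\<in>I. ?f i (i \<in> z)) = (\<Prod>i\<in>I-z. ?f i (i \<in> z)) * (\<Prod>i\<in>z. ?f i (i \<in> z))"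
        using fin by (intro prod.subset_diff) auto
      moreover have "(\<Prod>i\<in>I-z. ?f i (i \<in> z)) = (\<Prod>i\<in>I-z. ?f i False)"
        by (intro prod.cong) auto
      moreover have "(\<Prod>i\<in>z. ?f i (i \<in> z)) = (\<Prod>i\<in>z. ?f i True)"
        by (intro prod.cong) auto
      ultimately show "cube_form I b z * m x z = (\<Prod>i\<in>z. ?f i True) * (\<Prod>i\<in>I-z. ?f i False)"
        by (simp add: cube_form_def m_def prod.distrib[symmetric])
    qed
    also have "\<dots> = (\<Prod>i\<in>I. ?f i True + ?f i False)"
      using fin by (rule prod_add[symmetric])
    also have "\<dots> = 0"
      using fin i by (intro prod_zero) (auto intro!: bexI[of _ i])
    finally show ?thesis .
  qed
  have "(\<Sum>b\<in>Pow I. (u b)\<^sup>2) \<le> (\<Sum>b\<in>Pow I. \<Sum>z\<in>Pow I. u b * u z * cube_form I b z)"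
    using fin by (rule cube_form_ge)
  also have "\<dots> = 0"
  proof (rule sum.neutral, rule ballI)
    fix b assume b: "b \<in> Pow I"
    show "(\<Sum>z\<in>Pow I. u b * u z * cube_form I b z) = 0"
    proof (cases "u b = 0")
      case False
      with b uA c(2) have "I - b \<notin> B" by (auto simp: G_def u_def)
      have "(\<Sum>z\<in>Pow I. u b * u z * cube_form I b z)
          = (\<Sum>z\<in>Pow I. \<Sum>x\<in>X. u b * c x * (cube_form I b z * m x z))"
        by (intro sum.cong refl)
           (subst (2) u_def, simp add: sum_distrib_left sum_distrib_right mult_ac)
      also have "\<dots> = (\<Sum>x\<in>X. u b * c x * (\<Sum>z\<in>Pow I. cube_form I b z * m x z))"
        by (subst sum.swap) (simp add: sum_distrib_left)
      also have "\<dots> = 0"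
        using orth[OF b \<open>I - b \<notin> B\<close>] by (intro sum.neutral) auto
      finally show ?thesis .
    qed simp
  qed
  finally have "(\<Sum>b\<in>Pow I. (u b)\<^sup>2) = 0"
    by (intro antisym sum_nonneg) auto
  then have "\<forall>b\<in>Pow I. (u b)\<^sup>2 = 0"
    using fin by (subst (asm) sum_nonneg_eq_0_iff) auto
  then have u0: "u z = 0" if "z \<in> X" for z using that X by auto
  have "\<forall>x\<in>X. c x = 0"
  proof (rule odd_diagonal_imp_zero[OF finX, where m = m])
    show "even (m x z)" if "x \<in> X" "z \<in> X" "x \<noteq> z" for x z
    proof -
      from that X obtain i where i: "i \<in> I" "(i \<in> x) \<noteq> (i \<in> z)" by blast
      have "(if i \<in> x \<longleftrightarrow> i \<in> z then 1 else if i \<in> K x then 0 else 2) dvd m x z"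
        unfolding m_def using fin i(1) by (rule dvd_prodI)
      with i show ?thesis by (auto split: if_splits)
    qed
  qed (use u0 in \<open>auto simp: m_def u_def\<close>)
  with c(1) show False by blast
qed

section \<open>Disjoint occurrence and Reimer's inequality for product laws\<close>

definition cyl :: "'a set \<Rightarrow> ('a \<Rightarrow> 'b) \<Rightarrow> ('a \<Rightarrow> 'b) set" where
  "cyl K \<omega> = {\<eta>. \<forall>x\<in>K. \<eta> x = \<omega> x}"

text \<open>The box operation. The certificates \<open>K\<close> and \<open>L\<close> may depend on
  the configuration, so the notion makes sense for arbitrary, not only monotone, events.\<close>

definition disj_occ :: "('a \<Rightarrow> 'b) set \<Rightarrow> ('a \<Rightarrow> 'b) set \<Rightarrow> ('a \<Rightarrow> 'b) set" where
  "disj_occ A B = {\<omega>. \<exists>K L. K \<inter> L = {} \<and> cyl K \<omega> \<subseteq> A \<and> cyl L \<omega> \<subseteq> B}"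

definition swap_on :: "'a set \<Rightarrow> ('a \<Rightarrow> 'b) \<times> ('a \<Rightarrow> 'b) \<Rightarrow> ('a \<Rightarrow> 'b) \<times> ('a \<Rightarrow> 'b)" where
  "swap_on s z = (\<lambda>x. if x \<in> s then snd z x else fst z x, \<lambda>x. if x \<in> s then fst z x else snd z x)"

lemma swap_on_swap_on [simp]: "swap_on s (swap_on s z) = z"
  by (auto simp: swap_on_def prod_eq_iff)

lemma map_swap_on_Pi_pmf:
  assumes "finite I"
  shows "map_pmf (swap_on s) (pair_pmf (Pi_pmf I dflt q) (Pi_pmf I dflt q))
       = pair_pmf (Pi_pmf I dflt q) (Pi_pmf I dflt q)"
proof (rule pmf_eqI)
  fix z :: "('a \<Rightarrow> 'b) \<times> ('a \<Rightarrow> 'b)"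
  let ?P = "Pi_pmf I dflt q"
  have "inj (swap_on s :: _ \<Rightarrow> ('a \<Rightarrow> 'b) \<times> ('a \<Rightarrow> 'b))"
    by (metis injI swap_on_swap_on)
  then have "pmf (map_pmf (swap_on s) (pair_pmf ?P ?P)) z = pmf (pair_pmf ?P ?P) (swap_on s z)"
    by (metis pmf_map_inj' swap_on_swap_on)
  also have "\<dots> = pmf ?P (fst (swap_on s z)) * pmf ?P (snd (swap_on s z))"
    by (cases "swap_on s z") (simp add: pmf_pair)
  also have "\<dots> = pmf ?P (fst z) * pmf ?P (snd z)"
  proof (cases "\<forall>x. x \<notin> I \<longrightarrow> fst z x = dflt \<and> snd z x = dflt")
    case True
    then show ?thesis using assms
      by (simp add: pmf_Pi swap_on_def prod.distrib[symmetric] if_distrib mult.commute cong: if_cong)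
  next
    case False
    then have "(\<exists>x. x \<notin> I \<and> fst (swap_on s z) x \<noteq> dflt) \<or> (\<exists>x. x \<notin> I \<and> snd (swap_on s z) x \<noteq> dflt)"
      by (auto simp: swap_on_def)
    with False show ?thesis using assms by (auto simp: pmf_Pi)
  qed
  also have "\<dots> = pmf (pair_pmf ?P ?P) z"
    by (cases z) (simp add: pmf_pair)
  finally show "pmf (map_pmf (swap_on s) (pair_pmf ?P ?P)) z = pmf (pair_pmf ?P ?P) z" .
qed

lemma prob_pair_pmf_Times:
  "measure_pmf.prob (pair_pmf M N) (A \<times> B) = measure_pmf.prob M A * measure_pmf.prob N B"
proof -
  have "measure_pmf.prob (pair_pmf M N) (A \<times> B)
      = measure_pmf.prob (pair_pmf M N) ((A \<inter> set_pmf M) \<times> (B \<inter> set_pmf N))"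
    by (intro measure_prob_cong_0) (auto simp: pmf_pair set_pmf_iff)
  also have "\<dots> = measure_pmf.prob M (A \<inter> set_pmf M) * measure_pmf.prob N (B \<inter> set_pmf N)"
    by (intro measure_pmf_prob_product countable_Int2 countable_set_pmf)
  finally show ?thesis by (simp add: measure_Int_set_pmf)
qed

text \<open>
  Exchanging two independent configurations on a random set of coordinates leaves their joint law
  unchanged. Given the two configurations, only the uniform choice of the set remains random, and
  for this choice the inequality is the combinatorial one on the cube.
\<close>

theorem reimer_inequality:
  assumes fin: "finite I"
  shows "measure_pmf.prob (Pi_pmf I dflt q) (disj_occ A B)
       \<le> measure_pmf.prob (Pi_pmf I dflt q) A * measure_pmf.prob (Pi_pmf I dflt q) B"
proof -
  let ?P = "Pi_pmf I dflt q"
  define PP where "PP = pair_pmf ?P ?P"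
  have cond: "card {s \<in> Pow I. fst (swap_on s z) \<in> disj_occ A B}
            \<le> card {s \<in> Pow I. fst (swap_on s z) \<in> A \<and> snd (swap_on s z) \<in> B}"
    if z: "z \<in> set_pmf PP" for z
  proof -
    define X where "X = {s \<in> Pow I. fst (swap_on s z) \<in> disj_occ A B}"
    define w where "w s = fst (swap_on s z)" for s
    have out: "fst z x = dflt" "snd z x = dflt" if "x \<notin> I" for x
      using z that set_Pi_pmf_subset[OF fin, of dflt q] by (auto simp: PP_def)
    \<comment> \<open>Swapping on the complement exchanges the two configurations, which agree off
      \<open>I\<close>. Thus \<open>I - s\<close> in the cube inequality stands for the second
      configuration.\<close>
    have compl: "w (I - s) = snd (swap_on s z)" if "s \<subseteq> I" for s
      using that by (auto simp: w_def swap_on_def fun_eq_iff out)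
    have "\<forall>s\<in>X. \<exists>K L. K \<inter> L = {} \<and> cyl K (w s) \<subseteq> A \<and> cyl L (w s) \<subseteq> B"
      by (simp add: X_def disj_occ_def w_def)
    then obtain K L where KL: "\<And>s. s \<in> X \<Longrightarrow> K s \<inter> L s = {}"
      "\<And>s. s \<in> X \<Longrightarrow> cyl (K s) (w s) \<subseteq> A" "\<And>s. s \<in> X \<Longrightarrow> cyl (L s) (w s) \<subseteq> B"
      by metis
    have "card X \<le> card {s \<in> Pow I. s \<in> {s. w s \<in> A} \<and> I - s \<in> {s. w s \<in> B}}"
    proof (rule reimer_cube[OF fin])
      fix s t assume s: "s \<in> X" and t: "t \<subseteq> I" and eq: "\<And>i. i \<in> I \<inter> K s \<Longrightarrow> i \<in> t \<longleftrightarrow> i \<in> s"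
      have "w t \<in> cyl (K s) (w s)"
        using eq s t by (auto simp: cyl_def w_def swap_on_def out X_def)
      then show "t \<in> {s. w s \<in> A}" using KL(2)[OF s] by auto
    next
      fix s t assume s: "s \<in> X" and t: "t \<subseteq> I" and eq: "\<And>i. i \<in> I - K s \<Longrightarrow> i \<in> t \<longleftrightarrow> i \<in> s"
      have "w t \<in> cyl (L s) (w s)"
        using eq s t KL(1)[OF s] by (auto simp: cyl_def w_def swap_on_def out X_def)
      then show "t \<in> {s. w s \<in> B}" using KL(3)[OF s] by auto
    qed (auto simp: X_def)
    also have "{s \<in> Pow I. s \<in> {s. w s \<in> A} \<and> I - s \<in> {s. w s \<in> B}}
        = {s \<in> Pow I. fst (swap_on s z) \<in> A \<and> snd (swap_on s z) \<in> B}"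
      using compl by (auto simp: w_def)
    finally show ?thesis by (simp add: X_def)
  qed
  have inv: "measure_pmf.prob PP {z. swap_on s z \<in> E} = measure_pmf.prob PP E" for s E
    using map_swap_on_Pi_pmf[OF fin, of s dflt q] measure_map_pmf[of "swap_on s" PP E]
    by (simp add: PP_def vimage_def)
  have avg: "(\<Sum>s\<in>Pow I. measure_pmf.prob PP {z. swap_on s z \<in> E})
      = measure_pmf.expectation PP (\<lambda>z. real (card {s \<in> Pow I. swap_on s z \<in> E}))" for E
  proof -
    have "real (card {s \<in> Pow I. swap_on s z \<in> E})
        = (\<Sum>s\<in>Pow I. indicat_real {z. swap_on s z \<in> E} z)" for z
      using fin by (simp add: indicator_def sum.If_cases Int_def)
    then show ?thesis
      by (simp add: Bochner_Integration.integral_sum measure_pmf.integrable_const_bound[where B=1])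
  qed
  have int: "integrable PP (\<lambda>z. real (card {s \<in> Pow I. swap_on s z \<in> E}))" for E
    using fin by (intro measure_pmf.integrable_const_bound[where B="real (card (Pow I))"])
      (auto intro!: card_mono)
  have "real (card (Pow I)) * measure_pmf.prob ?P (disj_occ A B)
      = (\<Sum>s\<in>Pow I. measure_pmf.prob PP {z. swap_on s z \<in> disj_occ A B \<times> UNIV})"
    unfolding inv by (simp add: PP_def prob_pair_pmf_Times)
  also have "\<dots> \<le> (\<Sum>s\<in>Pow I. measure_pmf.prob PP {z. swap_on s z \<in> A \<times> B})"
    unfolding avg using cond
    by (intro integral_mono_AE int) (auto simp: AE_measure_pmf_iff mem_Times_iff)
  also have "\<dots> = real (card (Pow I)) * (measure_pmf.prob ?P A * measure_pmf.prob ?P B)"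
    unfolding inv by (simp add: PP_def prob_pair_pmf_Times)
  finally show ?thesis using fin by (simp add: card_Pow)
qed

section \<open>Disjoint trees in a finite volume\<close>

definition linked :: "'v rel \<Rightarrow> 'v set \<Rightarrow> 'v \<Rightarrow> 'v \<Rightarrow> bool" where
  "linked E K x y \<longleftrightarrow> (x, y) \<in> (E \<inter> K \<times> K)\<^sup>*"

lemma linked_refl [simp]: "linked E K x x"
  by (simp add: linked_def)

lemma linked_step: "linked E K x y \<Longrightarrow> (y, z) \<in> E \<Longrightarrow> y \<in> K \<Longrightarrow> z \<in> K \<Longrightarrow> linked E K x z"
  unfolding linked_def by (rule rtrancl_into_rtrancl) auto

lemma linked_first: "(x, y) \<in> E \<Longrightarrow> x \<in> K \<Longrightarrow> y \<in> K \<Longrightarrow> linked E K y z \<Longrightarrow> linked E K x z"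
  unfolding linked_def by (rule converse_rtrancl_into_rtrancl) auto

lemma linked_mono: "linked E K x y \<Longrightarrow> E \<inter> K \<times> K \<subseteq> E' \<Longrightarrow> K \<subseteq> K' \<Longrightarrow> linked E' K' x y"
  unfolding linked_def by (rule subsetD[OF rtrancl_mono, rotated]) auto

lemma linked_mem: "linked E K x y \<Longrightarrow> x \<in> K \<Longrightarrow> y \<in> K"
  unfolding linked_def by (induction rule: rtrancl_induct) auto

lemma linked_eq_or_mem: "linked E K x y \<Longrightarrow> x = y \<or> x \<in> K"
  unfolding linked_def by (induction rule: converse_rtrancl_induct) auto

text \<open>Cut the path at its last visit to \<open>v\<close>: along the path every return to
  \<open>v\<close> discards the part collected so far, and what remains lies in
  \<open>K\<close>.\<close>

lemma linked_last_exit: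
  assumes "linked E (insert v K) v y" "y \<noteq> v" "v \<notin> K"
  obtains w where "(v, w) \<in> E" "w \<in> K" "linked E K w y"
proof -
  have "y = v \<or> (\<exists>w. (v, w) \<in> E \<and> w \<in> K \<and> linked E K w y)"
    using assms(1) unfolding linked_def[of E "insert v K"]
  proof (induction rule: rtrancl_induct)
    case (step y z)
    show ?case
    proof (cases "z = v \<or> y = v")
      case False
      with step obtain w where "(v, w) \<in> E" "w \<in> K" "linked E K w y" by auto
      with step False show ?thesis by (auto intro: linked_step)
    qed (use step in auto)
  qed auto
  then show thesis using that assms by blast
qed

text \<open>A set that no step inside \<open>K\<close> leaves is a trap: a path that ends outside it
  has never been in it.\<close>

lemma linked_restrict_out:
  assumes "linked E K x y" "x \<in> K" "y \<notin> K1"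
    and closed: "\<And>u v. u \<in> K1 \<Longrightarrow> (u, v) \<in> E \<Longrightarrow> v \<in> K \<Longrightarrow> v \<in> K1"
  shows "x \<in> K - K1 \<and> linked E (K - K1) x y"
  using assms(1) unfolding linked_def[of E K]
proof (induction rule: converse_rtrancl_induct)
  case base
  then show ?case using assms linked_mem by (metis DiffI linked_refl)
next
  case (step u v)
  then have "u \<in> K - K1" using closed by blast
  with step show ?case by (auto intro: linked_first)
qed

lemma linked_restrict_in:
  assumes "linked E K x y" "x \<in> K1"
    and closed: "\<And>u v. u \<in> K1 \<Longrightarrow> (u, v) \<in> E \<Longrightarrow> v \<in> K \<Longrightarrow> v \<in> K1"
  shows "linked E K1 x y"
proof -
  have "y \<in> K1 \<and> linked E K1 x y"
    using assms(1) unfolding linked_def[of E K]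
    by (induction rule: rtrancl_induct) (auto intro: assms linked_step)
  then show ?thesis by blast
qed

text \<open>
  \<open>Q\<close> is a path from \<open>w\<close> to the current vertex \<open>v\<close>; as long as all targets lie in one component of
  the unexplored part, \<open>v\<close> moves one step into that component.
\<close>

lemma branching_point:
  assumes "finite K" "w \<in> Q" "v \<in> Q" "Q \<inter> K = {}" "linked E Q w v"
    and "\<And>i. i \<in> J \<Longrightarrow> linked E (insert v K) v (f i)" "J \<noteq> {}" "\<And>i. J \<noteq> {i}"
  shows "\<exists>v' Q' K1 K2 J1. w \<in> Q' \<and> v' \<in> Q' \<and> Q' \<subseteq> Q \<union> K \<and> linked E Q' w v'
      \<and> K1 \<union> K2 \<subseteq> K \<and> Q' \<inter> (K1 \<union> K2) = {} \<and> K1 \<inter> K2 = {} \<and> J1 \<noteq> {} \<and> J1 \<subset> J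
      \<and> (\<forall>i\<in>J1. linked E (insert v' K1) v' (f i)) \<and> (\<forall>i\<in>J-J1. linked E (insert v' K2) v' (f i))"
  using assms
proof (induction "card K" arbitrary: K Q v rule: less_induct)
  case less
  note prems = less.prems
  have vK: "v \<notin> K" using prems by blast
  show ?case
  proof (cases "\<exists>i\<in>J. f i = v")
    \<comment> \<open>The current vertex is itself a target. It is split off with an empty region,
      and the other targets keep all of \<open>K\<close>.\<close>
    case True
    then obtain i where "i \<in> J" "f i = v" by blast
    with prems show ?thesis
      by (intro exI[of _ v] exI[of _ Q] exI[of _ "{}"] exI[of _ K] exI[of _ "{i}"]) auto
  next
    case False
    obtain i0 where i0: "i0 \<in> J" using prems by blast
    have "f i0 \<noteq> v" using False i0 by blast
    then obtain w' where w': "(v, w') \<in> E" "w' \<in> K" "linked E K w' (f i0)"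
      using vK prems(6)[OF i0] by (metis linked_last_exit)
    \<comment> \<open>\<open>K1\<close> is what \<open>w'\<close> reaches inside \<open>K\<close>.
      No step inside \<open>K\<close> leaves it, so targets outside it are reached from
      \<open>v\<close> through \<open>K - K1\<close>, a disjoint region.\<close>
    define K1 where "K1 = {y \<in> K. linked E K w' y}"
    have K1: "w' \<in> K1" "K1 \<subseteq> K" using w' by (auto simp: K1_def)
    have closed: "b \<in> K1" if "a \<in> K1" "(a, b) \<in> E" "b \<in> K" for a b
      using that by (auto simp: K1_def intro: linked_step)
    have in_K1: "linked E K1 w' y" if "y \<in> K1" for y
    proof (rule linked_restrict_in[OF _ K1(1) closed])
      show "linked E K w' y" using that by (simp add: K1_def)
    qed
    define J1 where "J1 = {i \<in> J. f i \<in> K1}"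
    have i0J1: "i0 \<in> J1" using i0 w' linked_mem by (fastforce simp: J1_def K1_def)
    show ?thesis
    proof (cases "J1 = J")
      case False
      have "linked E (insert v K1) v (f i)" if "i \<in> J1" for i
      proof -
        have "linked E (insert v K1) w' (f i)"
          using in_K1[of "f i"] that by (auto simp: J1_def intro: linked_mono)
        with w' K1 show ?thesis by (intro linked_first[of v w']) auto
      qed
      moreover have "linked E (insert v (K - K1)) v (f i)" if "i \<in> J - J1" for i
      proof -
        have "f i \<noteq> v" "linked E (insert v K) v (f i)"
          using that prems(6) \<open>\<not> (\<exists>i\<in>J. f i = v)\<close> by auto
        then obtain u where u: "(v, u) \<in> E" "u \<in> K" "linked E K u (f i)"
          using linked_last_exit vK by metis
        then have "u \<in> K - K1 \<and> linked E (K - K1) u (f i)"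
          using that closed by (intro linked_restrict_out) (auto simp: J1_def)
        then have "linked E (insert v (K - K1)) u (f i)" "u \<in> K - K1"
          by (auto intro: linked_mono)
        with u show ?thesis by (intro linked_first[of v u]) auto
      qed
      moreover have "J1 \<subset> J" using False by (auto simp: J1_def)
      moreover have "Q \<inter> (K1 \<union> (K - K1)) = {}" using prems(4) K1 by blast
      moreover have "K1 \<union> (K - K1) \<subseteq> K" "J1 \<noteq> {}" "Q \<subseteq> Q \<union> K" "K1 \<inter> (K - K1) = {}"
        using K1 i0J1 by auto
      ultimately show ?thesis using prems(2,3,5)
        by (intro exI[of _ v] exI[of _ Q] exI[of _ K1] exI[of _ "K - K1"] exI[of _ J1] conjI ballI)
    next
      \<comment> \<open>All targets lie in \<open>K1\<close>, so there is no branching at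
        \<open>v\<close> yet: the path is extended to \<open>w'\<close>, and the region shrinks to
        \<open>K1 - {w'}\<close>.\<close>
      case True
      have less: "card (K1 - {w'}) < card K"
        using prems(1) K1 by (intro psubset_card_mono) auto
      have fin: "finite (K1 - {w'})" using prems(1) K1 finite_subset by blast
      have Q: "w \<in> insert w' Q" "w' \<in> insert w' Q" "insert w' Q \<inter> (K1 - {w'}) = {}"
        using prems K1 by auto
      have path: "linked E (insert w' Q) w w'"
      proof (rule linked_step[OF _ w'(1)])
        show "linked E (insert w' Q) w v" by (rule linked_mono[OF prems(5)]) auto
      qed (use prems(3) in auto)
      have targets: "linked E (insert w' (K1 - {w'})) w' (f i)" if "i \<in> J" for i
      proof -
        have "i \<in> J1" using that True by simp
        then have "f i \<in> K1" by (simp add: J1_def)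
        moreover have "insert w' (K1 - {w'}) = K1" using K1 by auto
        ultimately show ?thesis using in_K1 by simp
      qed
      obtain v' Q' L1 L2 I1 where
        "w \<in> Q'" "v' \<in> Q'" "Q' \<subseteq> insert w' Q \<union> (K1 - {w'})" "linked E Q' w v'"
        "L1 \<union> L2 \<subseteq> K1 - {w'}" "Q' \<inter> (L1 \<union> L2) = {}" "L1 \<inter> L2 = {}" "I1 \<noteq> {}" "I1 \<subset> J"
        "\<forall>i\<in>I1. linked E (insert v' L1) v' (f i)" "\<forall>i\<in>J-I1. linked E (insert v' L2) v' (f i)"
        using less.hyps[OF less fin Q path targets prems(7,8)] by blast
      moreover have "Q' \<subseteq> Q \<union> K" "L1 \<union> L2 \<subseteq> K" using calculation(3,5) K1 by auto
      ultimately show ?thesis by blast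
    qed
  qed
qed

section \<open>Tree events and their certificates\<close>

locale finite_percolation =
  fixes V :: "'v set" and N :: "'v rel" and E :: "('v \<Rightarrow> 's) \<Rightarrow> 'v rel"
    and dflt :: 's and q :: "'v \<Rightarrow> 's pmf"
  assumes finite_V: "finite V"
    and E_subset: "E \<omega> \<subseteq> N"
    and E_local: "\<omega> x = \<eta> x \<Longrightarrow> \<omega> y = \<eta> y \<Longrightarrow> (x, y) \<in> E \<omega> \<longleftrightarrow> (x, y) \<in> E \<eta>"
begin

abbreviation pr :: "('v \<Rightarrow> 's) set \<Rightarrow> real" where
  "pr \<equiv> measure_pmf.prob (Pi_pmf V dflt q)"

text \<open>By locality the edges inside \<open>K\<close> are read off from the states on
  \<open>K\<close>. A path is therefore certified by the states of its vertices.\<close>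

lemma linked_cyl: "\<eta> \<in> cyl K \<omega> \<Longrightarrow> linked (E \<omega>) K x y \<Longrightarrow> linked (E \<eta>) K x y"
  by (erule linked_mono) (auto simp: cyl_def E_local[of \<omega> _ \<eta>])

text \<open>
  Connection of \<open>w\<close> to \<open>v\<close> by a path that is open after its first step and whose edges do not
  depend on the state of \<open>w\<close>.
\<close>

definition reach :: "'v \<Rightarrow> 'v \<Rightarrow> ('v \<Rightarrow> 's) set" where
  "reach w v = {\<omega>. w = v \<or> (\<exists>w'. (w, w') \<in> N \<and> linked (E \<omega>) (V - {w}) w' v)}"

text \<open>
  Binary trees of disjoint connections from \<open>w\<close> to the points \<open>f i\<close>. The number \<open>k\<close> only bounds the
  depth of the recursion.
\<close>

primrec tree_event :: "nat \<Rightarrow> 'v \<Rightarrow> (nat \<Rightarrow> 'v) \<Rightarrow> nat set \<Rightarrow> ('v \<Rightarrow> 's) set" where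
  "tree_event 0 w f J = {}"
| "tree_event (Suc k) w f J =
    (if card J = 1 then reach w (f (Min J))
     else \<Union>v\<in>V. \<Union>J1\<in>{J1. J1 \<subset> J \<and> Min J \<in> J1}.
       disj_occ (reach w v) (disj_occ (tree_event k v f J1) (tree_event k v f (J - J1))))"

text \<open>After its last visit to \<open>w\<close> the path stays in \<open>K\<close> and remains
  open as long as the states on \<open>K\<close> are kept. Its first step also depends on the state
  of \<open>w\<close>, so only the underlying arc in \<open>N\<close> is recorded.\<close>

lemma cyl_subset_reach:
  assumes "linked (E \<omega>) (insert w K) w v" "w \<notin> K" "K \<subseteq> V"
  shows "cyl K \<omega> \<subseteq> reach w v"
proof
  fix \<eta> assume \<eta>: "\<eta> \<in> cyl K \<omega>"
  show "\<eta> \<in> reach w v"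
  proof (cases "w = v")
    case False
    then obtain w' where w': "(w, w') \<in> E \<omega>" "w' \<in> K" "linked (E \<omega>) K w' v"
      using assms linked_last_exit by metis
    then have "linked (E \<eta>) (V - {w}) w' v"
      using assms linked_cyl[OF \<eta> w'(3)] by (auto intro: linked_mono)
    with w' E_subset show ?thesis by (auto simp: reach_def)
  qed (simp add: reach_def)
qed

lemma cyl_cyl: "\<eta> \<in> cyl K \<omega> \<Longrightarrow> L \<subseteq> K \<Longrightarrow> cyl L \<eta> = cyl L \<omega>"
  by (auto simp: cyl_def)

lemma cyl_subset_disj_occ:
  assumes "cyl K1 \<omega> \<subseteq> A" "cyl K2 \<omega> \<subseteq> B" "K1 \<inter> K2 = {}" "K1 \<union> K2 \<subseteq> K"
  shows "cyl K \<omega> \<subseteq> disj_occ A B"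
proof
  fix \<eta> assume "\<eta> \<in> cyl K \<omega>"
  with assms have "cyl K1 \<eta> \<subseteq> A" "cyl K2 \<eta> \<subseteq> B"
    by (auto simp: cyl_cyl[of \<eta> K \<omega>])
  with assms(3) show "\<eta> \<in> disj_occ A B" by (auto simp: disj_occ_def)
qed

text \<open>The branching vertex \<open>v\<close> is common to the incoming path and both subtrees.
  Its state is used at most by the incoming path, certified on \<open>Q - {w}\<close>; the subtrees
  are certified on \<open>K1\<close> and \<open>K2\<close>, which avoid \<open>Q\<close>. So the
  three certificates are disjoint.\<close>

lemma cyl_subset_tree_event:
  assumes "finite J" "J \<noteq> {}" "card J \<le> k" "w \<in> V" "w \<notin> K" "K \<subseteq> V"
    and "\<And>i. i \<in> J \<Longrightarrow> linked (E \<omega>) (insert w K) w (f i)"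
  shows "cyl K \<omega> \<subseteq> tree_event k w f J"
  using assms
proof (induction k arbitrary: J w K)
  case (Suc k)
  note prems = Suc.prems
  show ?case
  proof (cases "card J = 1")
    case True
    have "Min J \<in> J" using prems by simp
    with prems have "cyl K \<omega> \<subseteq> reach w (f (Min J))" by (intro cyl_subset_reach) auto
    with True show ?thesis by simp
  next
    case False
    then have "J \<noteq> {i}" for i by auto
    then obtain v Q K1 K2 J1 where b: "w \<in> Q" "v \<in> Q" "Q \<subseteq> {w} \<union> K" "linked (E \<omega>) Q w v"
      "K1 \<union> K2 \<subseteq> K" "Q \<inter> (K1 \<union> K2) = {}" "K1 \<inter> K2 = {}" "J1 \<noteq> {}" "J1 \<subset> J"
      "\<forall>i\<in>J1. linked (E \<omega>) (insert v K1) v (f i)" "\<forall>i\<in>J-J1. linked (E \<omega>) (insert v K2) v (f i)"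
      using branching_point[of K w "{w}" w "E \<omega>" J f] prems(2,5,7) finite_subset[OF prems(6) finite_V]
      by (simp only: insertI1 linked_refl) blast
    have v: "v \<in> V" using b prems by blast
    have cards: "card J1 < card J" "card (J - J1) < card J"
      using b prems by (auto intro!: psubset_card_mono)
    have J1: "finite J1" "finite (J - J1)" "J - J1 \<noteq> {}"
      using b(9) prems(1) by (auto intro: finite_subset)
    have K12: "v \<notin> K1" "v \<notin> K2" "K1 \<subseteq> V" "K2 \<subseteq> V"
      using b(2,5,6) prems(6) by auto
    have 1: "cyl K1 \<omega> \<subseteq> tree_event k v f J1"
      using b(8,10) prems(3) v cards J1 K12 by (intro Suc.IH) auto
    have 2: "cyl K2 \<omega> \<subseteq> tree_event k v f (J - J1)"
      using b(11) prems(3) v cards J1 K12 by (intro Suc.IH) auto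
    have "cyl (Q - {w}) \<omega> \<subseteq> reach w v"
      using b prems by (intro cyl_subset_reach) (auto simp: insert_absorb)
    \<comment> \<open>The subtrees play symmetric roles. The one carrying \<open>Min J\<close> is
      listed first, so each splitting of the leaves occurs only once in
      \<open>tree_event\<close>.\<close>
    moreover have "\<exists>J2. J2 \<subset> J \<and> Min J \<in> J2
      \<and> cyl (K1 \<union> K2) \<omega> \<subseteq> disj_occ (tree_event k v f J2) (tree_event k v f (J - J2))"
    proof (cases "Min J \<in> J1")
      case True
      with b 1 2 show ?thesis by (intro exI[of _ J1] conjI cyl_subset_disj_occ[of K1 _ _ K2]) auto
    next
      case False
      have "J - (J - J1) = J1" "Min J \<in> J" using b prems by auto
      with b 1 2 False show ?thesis
        by (intro exI[of _ "J - J1"] conjI cyl_subset_disj_occ[of K2 _ _ K1]) auto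
    qed
    then obtain J2 where J2: "J2 \<subset> J" "Min J \<in> J2"
      "cyl (K1 \<union> K2) \<omega> \<subseteq> disj_occ (tree_event k v f J2) (tree_event k v f (J - J2))"
      by blast
    ultimately have
      "cyl K \<omega> \<subseteq> disj_occ (reach w v) (disj_occ (tree_event k v f J2) (tree_event k v f (J - J2)))"
      using b(3,5,6) by (elim cyl_subset_disj_occ) auto
    with v J2(1,2) show ?thesis using False by auto
  qed
qed simp

end

section \<open>Summation over trees and moment bounds\<close>

lemma sum_Pow_card:
  fixes g :: "nat \<Rightarrow> 'b :: semiring_1"
  assumes "finite J"
  shows "(\<Sum>S\<in>Pow J. g (card S)) = (\<Sum>j\<le>card J. of_nat (card J choose j) * g j)"
proof -
  have "(\<Sum>S\<in>Pow J. g (card S)) = (\<Sum>j\<le>card J. \<Sum>S\<in>{S \<in> Pow J. card S = j}. g (card S))"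
    using assms by (intro sum.group[symmetric]) (auto intro: card_mono)
  also have "\<dots> = (\<Sum>j\<le>card J. of_nat (card J choose j) * g j)"
    using n_subsets[OF assms] by (intro sum.cong) auto
  finally show ?thesis .
qed

lemma sum_PiE_split:
  fixes X Y :: "('i \<Rightarrow> 'a) \<Rightarrow> real"
  assumes "J1 \<subseteq> J"
    and X: "\<And>f g. (\<And>i. i \<in> J1 \<Longrightarrow> f i = g i) \<Longrightarrow> X f = X g"
    and Y: "\<And>f g. (\<And>i. i \<in> J - J1 \<Longrightarrow> f i = g i) \<Longrightarrow> Y f = Y g"
  shows "(\<Sum>f\<in>J \<rightarrow>\<^sub>E V. X f * Y f) = (\<Sum>f\<in>J1 \<rightarrow>\<^sub>E V. X f) * (\<Sum>f\<in>(J - J1) \<rightarrow>\<^sub>E V. Y f)"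
proof -
  have "(\<Sum>f\<in>J \<rightarrow>\<^sub>E V. X f * Y f) = (\<Sum>(g, h)\<in>(J1 \<rightarrow>\<^sub>E V) \<times> ((J - J1) \<rightarrow>\<^sub>E V). X g * Y h)"
  proof (rule sum.reindex_bij_witness[where j = "\<lambda>f. (restrict f J1, restrict f (J - J1))"
        and i = "\<lambda>(g, h). \<lambda>i. if i \<in> J1 then g i else h i"])
    fix f assume f: "f \<in> J \<rightarrow>\<^sub>E V"
    have "X (restrict f J1) = X f" "Y (restrict f (J - J1)) = Y f"
      by (auto intro!: X Y)
    then show "(case (restrict f J1, restrict f (J - J1)) of (g, h) \<Rightarrow> X g * Y h) = X f * Y f"
      by simp
  qed (use assms(1) in \<open>auto simp: fun_eq_iff PiE_def extensional_def Pi_def\<close>)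
  then show ?thesis by (simp add: sum_product sum.cartesian_product)
qed

text \<open>For k \<ge> 1 this is B^(2k-1) times the number (2k-3)!! of rooted binary trees with k
  labelled leaves: one factor B for each of the 2k - 1 paths.\<close>

fun tree_bound :: "real \<Rightarrow> nat \<Rightarrow> real" where
  "tree_bound B k =
    (if k \<le> 1 then B
     else B / 2 * (\<Sum>j\<in>{1..<k}. real (k choose j) * (tree_bound B j * tree_bound B (k - j))))"

declare tree_bound.simps [simp del]

lemma tree_bound_nonneg: "B \<ge> 0 \<Longrightarrow> tree_bound B k \<ge> 0"
proof (induction k rule: less_induct)
  case (less k)
  then show ?case by (subst tree_bound.simps) (auto intro!: sum_nonneg mult_nonneg_nonneg)
qed

text \<open>Complementation exchanges the proper subsets containing \<open>Min J\<close> with the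
  nonempty ones avoiding it and preserves the summand. So the sum is half of that over all nonempty
  proper subsets, which explains the \<open>B / 2\<close> in \<open>tree_bound\<close>.\<close>

lemma sum_proper_subsets_Min:
  fixes a :: "nat \<Rightarrow> real"
  assumes "finite J" "J \<noteq> {}"
  shows "(\<Sum>J1 | J1 \<subset> J \<and> Min J \<in> J1. a (card J1) * a (card J - card J1))
    = (\<Sum>j\<in>{1..<card J}. real (card J choose j) * (a j * a (card J - j))) / 2"
proof -
  define k where "k = card J"
  \<comment> \<open>The value 0 at sizes 0 and \<open>k\<close> allows summing over all of
    \<open>Pow J\<close>.\<close>
  define h where "h j = (if 1 \<le> j \<and> j < k then a j * a (k - j) else 0)" for j
  let ?S = "{J1. J1 \<subset> J \<and> Min J \<in> J1}" and ?T = "{J1. J1 \<subseteq> J \<and> J1 \<noteq> {} \<and> Min J \<notin> J1}"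
  have m: "Min J \<in> J" using assms by simp
  have fin: "finite ?S" "finite ?T"
    using assms by (auto intro: finite_subset[of _ "Pow J"])
  have hS: "a (card J1) * a (k - card J1) = h (card J1)" if "J1 \<subset> J" "J1 \<noteq> {}" for J1
    using that assms psubset_card_mono[of J J1] finite_subset[of J1 J]
    by (auto simp: h_def k_def Suc_le_eq card_gt_0_iff)
  have S: "(\<Sum>J1\<in>?S. a (card J1) * a (k - card J1)) = (\<Sum>J1\<in>?S. h (card J1))"
    by (intro sum.cong hS) auto
  have "(\<Sum>J1\<in>?T. h (card J1)) = (\<Sum>J1\<in>?S. h (card J1))"
  proof (rule sum.reindex_bij_witness[where i = "\<lambda>A. J - A" and j = "\<lambda>A. J - A"])
    fix J1 assume J1: "J1 \<in> ?T"
    then have c: "card (J - J1) = k - card J1" "card J1 \<le> k"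
      using assms by (auto simp: k_def card_Diff_subset finite_subset card_mono)
    then show "h (card (J - J1)) = h (card J1)"
      by (auto simp: h_def)
  qed (use m in auto)
  then have "2 * (\<Sum>J1\<in>?S. h (card J1)) = (\<Sum>J1\<in>?S. h (card J1)) + (\<Sum>J1\<in>?T. h (card J1))"
    by simp
  also have "\<dots> = (\<Sum>J1\<in>?S \<union> ?T. h (card J1))"
    using fin by (intro sum.union_disjoint[symmetric]) auto
  also have "\<dots> = (\<Sum>J1\<in>Pow J. h (card J1))"
    using assms m by (intro sum.mono_neutral_left) (auto simp: h_def k_def)
  also have "\<dots> = (\<Sum>j\<le>k. real (k choose j) * h j)"
    using sum_Pow_card[OF assms(1), of h] by (simp add: k_def)
  also have "\<dots> = (\<Sum>j\<in>{1..<k}. real (k choose j) * h j)"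
    by (intro sum.mono_neutral_right) (auto simp: h_def)
  also have "\<dots> = (\<Sum>j\<in>{1..<k}. real (k choose j) * (a j * a (k - j)))"
    by (intro sum.cong) (auto simp: h_def)
  finally show ?thesis using S by (simp add: k_def)
qed

context finite_percolation
begin

lemma tree_event_cong:
  assumes "finite J" "J \<noteq> {}" "\<And>i. i \<in> J \<Longrightarrow> f i = g i"
  shows "tree_event k w f J = tree_event k w g J"
  using assms
proof (induction k arbitrary: w J)
  case (Suc k)
  have "tree_event k v f J1 = tree_event k v g J1" "tree_event k v f (J - J1) = tree_event k v g (J - J1)"
    if "J1 \<subset> J" "Min J \<in> J1" for v J1
  proof -
    have "finite J1" "J1 \<noteq> {}" "finite (J - J1)" "J - J1 \<noteq> {}"
      using that Suc.prems(1) by (auto intro: finite_subset)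
    then show "tree_event k v f J1 = tree_event k v g J1"
      "tree_event k v f (J - J1) = tree_event k v g (J - J1)"
      using that(1) Suc.prems(3) by (intro Suc.IH; blast)+
  qed
  moreover have "f (Min J) = g (Min J)" using Suc.prems by simp
  ultimately show ?case by simp
qed simp

text \<open>Reimer's inequality, used twice, separates the path and the two subtrees; their leaf
  positions are then summed separately, and last the branching vertex. Each path starts at a vertex
  that is itself summed over, so \<open>B\<close> has to be uniform in the start.\<close>

lemma sum_prob_tree_event_le:
  assumes B: "\<And>w. w \<in> V \<Longrightarrow> (\<Sum>v\<in>V. pr (reach w v)) \<le> B" "B \<ge> 0"
    and "finite J" "J \<noteq> {}" "card J \<le> k" "w \<in> V"
  shows "(\<Sum>f\<in>J \<rightarrow>\<^sub>E V. pr (tree_event k w f J)) \<le> tree_bound B (card J)"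
  using assms(3-)
proof (induction k arbitrary: w J)
  case (Suc k)
  note prems = Suc.prems
  show ?case
  proof (cases "card J = 1")
    case True
    then obtain i where i: "J = {i}" by (auto simp: card_Suc_eq)
    have "(\<Sum>f\<in>J \<rightarrow>\<^sub>E V. pr (tree_event (Suc k) w f J)) = (\<Sum>v\<in>V. pr (reach w v))"
      by (rule sum.reindex_bij_witness[where j = "\<lambda>f. f i" and i = "\<lambda>v. \<lambda>x\<in>{i}. v"])
        (auto simp: i fun_eq_iff PiE_def extensional_def)
    with B(1)[OF prems(4)] True show ?thesis by (simp add: tree_bound.simps[of B "Suc 0"])
  next
    case False
    let ?S = "{J1. J1 \<subset> J \<and> Min J \<in> J1}"
    let ?a = "tree_bound B"
    have finS: "finite ?S"
      using prems by (auto intro: finite_subset[of _ "Pow J"])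
    have "pr (tree_event (Suc k) w f J)
        \<le> (\<Sum>v\<in>V. \<Sum>J1\<in>?S. pr (reach w v) * (pr (tree_event k v f J1) * pr (tree_event k v f (J - J1))))" for f
    proof -
      let ?D = "\<lambda>v J1. disj_occ (reach w v) (disj_occ (tree_event k v f J1) (tree_event k v f (J - J1)))"
      have "pr (tree_event (Suc k) w f J) = pr (\<Union>v\<in>V. \<Union>J1\<in>?S. ?D v J1)"
        using False by simp
      also have "\<dots> \<le> (\<Sum>v\<in>V. pr (\<Union>J1\<in>?S. ?D v J1))"
        using finite_V by (intro measure_UNION_le) auto
      also have "\<dots> \<le> (\<Sum>v\<in>V. \<Sum>J1\<in>?S. pr (?D v J1))"
        using finS by (intro sum_mono measure_UNION_le) auto
      also have "\<dots> \<le> (\<Sum>v\<in>V. \<Sum>J1\<in>?S. pr (reach w v) *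
          (pr (tree_event k v f J1) * pr (tree_event k v f (J - J1))))"
        by (intro sum_mono order.trans[OF reimer_inequality[OF finite_V]] mult_left_mono
            reimer_inequality[OF finite_V]) auto
      finally show ?thesis .
    qed
    then have "(\<Sum>f\<in>J \<rightarrow>\<^sub>E V. pr (tree_event (Suc k) w f J))
        \<le> (\<Sum>f\<in>J \<rightarrow>\<^sub>E V. \<Sum>v\<in>V. \<Sum>J1\<in>?S. pr (reach w v) *
             (pr (tree_event k v f J1) * pr (tree_event k v f (J - J1))))"
      by (rule sum_mono)
    also have "\<dots> = (\<Sum>v\<in>V. \<Sum>f\<in>J \<rightarrow>\<^sub>E V. \<Sum>J1\<in>?S. pr (reach w v) *
             (pr (tree_event k v f J1) * pr (tree_event k v f (J - J1))))"
      by (rule sum.swap)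
    also have "\<dots> = (\<Sum>v\<in>V. \<Sum>J1\<in>?S. \<Sum>f\<in>J \<rightarrow>\<^sub>E V. pr (reach w v) *
             (pr (tree_event k v f J1) * pr (tree_event k v f (J - J1))))"
      by (intro sum.cong refl sum.swap)
    also have "\<dots> = (\<Sum>v\<in>V. \<Sum>J1\<in>?S. pr (reach w v) *
             ((\<Sum>f\<in>J1 \<rightarrow>\<^sub>E V. pr (tree_event k v f J1)) * (\<Sum>f\<in>(J-J1) \<rightarrow>\<^sub>E V. pr (tree_event k v f (J - J1)))))"
    proof (intro sum.cong refl)
      fix v J1 assume J1: "J1 \<in> ?S"
      have "(\<Sum>f\<in>J \<rightarrow>\<^sub>E V. pr (tree_event k v f J1) * pr (tree_event k v f (J - J1)))
        = (\<Sum>f\<in>J1 \<rightarrow>\<^sub>E V. pr (tree_event k v f J1)) * (\<Sum>f\<in>(J-J1) \<rightarrow>\<^sub>E V. pr (tree_event k v f (J - J1)))"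
        using J1 prems
        by (intro sum_PiE_split arg_cong[where f = pr] tree_event_cong) (auto intro: finite_subset)
      then show "(\<Sum>f\<in>J \<rightarrow>\<^sub>E V. pr (reach w v) * (pr (tree_event k v f J1) * pr (tree_event k v f (J - J1))))
        = pr (reach w v) * ((\<Sum>f\<in>J1 \<rightarrow>\<^sub>E V. pr (tree_event k v f J1)) *
            (\<Sum>f\<in>(J-J1) \<rightarrow>\<^sub>E V. pr (tree_event k v f (J - J1))))"
        by (simp add: sum_distrib_left[symmetric])
    qed
    also have "\<dots> \<le> (\<Sum>v\<in>V. \<Sum>J1\<in>?S. pr (reach w v) * (?a (card J1) * ?a (card J - card J1)))"
    proof (intro sum_mono mult_left_mono)
      fix v J1 assume v: "v \<in> V" and J1: "J1 \<in> ?S"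
      have c: "card J1 < card J" "card (J - J1) = card J - card J1" "card (J - J1) < card J"
        using J1 prems by (auto simp: card_Diff_subset finite_subset intro!: psubset_card_mono)
      have "(\<Sum>f\<in>J1 \<rightarrow>\<^sub>E V. pr (tree_event k v f J1)) \<le> ?a (card J1)"
        using J1 prems v c by (intro Suc.IH) (auto intro: finite_subset)
      moreover have "(\<Sum>f\<in>(J-J1) \<rightarrow>\<^sub>E V. pr (tree_event k v f (J - J1))) \<le> ?a (card (J - J1))"
        using J1 prems v c by (intro Suc.IH) auto
      ultimately show "(\<Sum>f\<in>J1 \<rightarrow>\<^sub>E V. pr (tree_event k v f J1)) *
          (\<Sum>f\<in>(J-J1) \<rightarrow>\<^sub>E V. pr (tree_event k v f (J - J1))) \<le> ?a (card J1) * ?a (card J - card J1)"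
        unfolding c(2) by (intro mult_mono tree_bound_nonneg B(2) sum_nonneg) auto
    qed auto
    also have "\<dots> = (\<Sum>v\<in>V. pr (reach w v)) * (\<Sum>J1\<in>?S. ?a (card J1) * ?a (card J - card J1))"
      by (simp add: sum_product)
    also have "\<dots> \<le> B * (\<Sum>J1\<in>?S. ?a (card J1) * ?a (card J - card J1))"
      using B prems by (intro mult_right_mono sum_nonneg mult_nonneg_nonneg tree_bound_nonneg) auto
    also have "\<dots> = ?a (card J)"
    proof -
      have "\<not> card J \<le> 1" using False prems by (auto simp: le_Suc_eq)
      then show ?thesis
        unfolding sum_proper_subsets_Min[OF prems(1,2)] by (subst (3) tree_bound.simps) simp
    qed
    finally show ?thesis .
  qed
qed simp

text \<open>Markov's inequality for the k-th moment: the k-th power of the cluster size counts the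
  maps from \<open>{..<k}\<close> into the cluster, repeated values allowed, and the tree event of
  each such map occurs.\<close>

lemma prob_cluster_moment_le:
  assumes B: "\<And>w. w \<in> V \<Longrightarrow> (\<Sum>v\<in>V. pr (reach w v)) \<le> B" "B \<ge> 0"
    and "r \<in> V" "k \<ge> 1"
  shows "real n ^ k * pr {\<omega>. n \<le> card {y \<in> V. linked (E \<omega>) V r y}} \<le> tree_bound B k"
proof -
  let ?C = "\<lambda>\<omega>. {y \<in> V. linked (E \<omega>) V r y}" and ?P = "Pi_pmf V dflt q"
  let ?F = "{..<k} \<rightarrow>\<^sub>E V"
  have finF: "finite ?F" using finite_V by (intro finite_PiE) auto
  have tree: "\<omega> \<in> tree_event k r f {..<k}" if "f \<in> {..<k} \<rightarrow>\<^sub>E ?C \<omega>" for f \<omega>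
  proof -
    have "cyl (V - {r}) \<omega> \<subseteq> tree_event k r f {..<k}"
      using assms that by (intro cyl_subset_tree_event) (auto simp: insert_absorb lessThan_empty_iff)
    then show ?thesis by (auto simp: cyl_def)
  qed
  have "real n ^ k * indicat_real {\<omega>. n \<le> card (?C \<omega>)} \<omega>
      \<le> (\<Sum>f\<in>?F. indicat_real (tree_event k r f {..<k}) \<omega>)" for \<omega>
  proof (cases "n \<le> card (?C \<omega>)")
    case True
    have "real n ^ k \<le> real (card (?C \<omega>)) ^ k" using True by (intro power_mono) auto
    also have "\<dots> = real (card ({..<k} \<rightarrow>\<^sub>E ?C \<omega>))" by (simp add: card_PiE)
    also have "\<dots> = (\<Sum>f\<in>{..<k} \<rightarrow>\<^sub>E ?C \<omega>. indicat_real (tree_event k r f {..<k}) \<omega>)"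
      using tree by simp
    also have "\<dots> \<le> (\<Sum>f\<in>?F. indicat_real (tree_event k r f {..<k}) \<omega>)"
      using finF by (intro sum_mono2 PiE_mono) auto
    finally show ?thesis using True by simp
  qed (auto intro: sum_nonneg)
  then have "measure_pmf.expectation ?P (\<lambda>\<omega>. real n ^ k * indicat_real {\<omega>. n \<le> card (?C \<omega>)} \<omega>)
      \<le> measure_pmf.expectation ?P (\<lambda>\<omega>. \<Sum>f\<in>?F. indicat_real (tree_event k r f {..<k}) \<omega>)"
    by (intro integral_mono integrable_mult_right Bochner_Integration.integrable_sum
        measure_pmf.integrable_const_bound[where B = 1]) auto
  then have "real n ^ k * pr {\<omega>. n \<le> card (?C \<omega>)} \<le> (\<Sum>f\<in>?F. pr (tree_event k r f {..<k}))"
    by (simp add: Bochner_Integration.integral_sum measure_pmf.integrable_const_bound[where B = 1])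
  also have "\<dots> \<le> tree_bound B (card {..<k})"
    using assms by (intro sum_prob_tree_event_le) (auto simp: lessThan_empty_iff)
  finally show ?thesis by simp
qed

end

text \<open>The partial sums satisfy S(m+1) \<le> B t + (B / 2) S(m)^2, and for t = 1 / (2 B^2) the
  value 1 / B is a fixed point of the right-hand side, so no partial sum exceeds it.\<close>

lemma tree_bound_partial_sum:
  assumes B: "B > 0"
  shows "(\<Sum>k=1..m. tree_bound B k * (1 / (2 * B\<^sup>2)) ^ k / fact k) \<le> 1 / B"
proof (induction m)
  case 0
  then show ?case using B by simp
next
  case (Suc m)
  define b where "b k = tree_bound B k * (1 / (2 * B\<^sup>2)) ^ k / fact k" for k
  have b_nonneg: "b k \<ge> 0" for k using B by (simp add: b_def tree_bound_nonneg)
  have rec: "b k = B / 2 * (\<Sum>j\<in>{1..<k}. b j * b (k - j))" if "k \<ge> 2" for k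
  proof -
    have "b k = B / 2 * (\<Sum>j\<in>{1..<k}. real (k choose j) * (tree_bound B j * tree_bound B (k - j))
        * (1 / (2 * B\<^sup>2)) ^ k / fact k)"
      using that unfolding b_def
      by (subst tree_bound.simps) (simp add: sum_distrib_right sum_distrib_left sum_divide_distrib mult.assoc)
    also have "(\<Sum>j\<in>{1..<k}. real (k choose j) * (tree_bound B j * tree_bound B (k - j))
        * (1 / (2 * B\<^sup>2)) ^ k / fact k) = (\<Sum>j\<in>{1..<k}. b j * b (k - j))"
    proof (intro sum.cong refl)
      fix j assume "j \<in> {1..<k}"
      then have "(1 / (2 * B\<^sup>2)) ^ k = (1 / (2 * B\<^sup>2)) ^ j * (1 / (2 * B\<^sup>2)) ^ (k - j)" "j \<le> k"
        by (auto simp flip: power_add)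
      then show "real (k choose j) * (tree_bound B j * tree_bound B (k - j)) * (1 / (2 * B\<^sup>2)) ^ k / fact k
          = b j * b (k - j)"
        by (simp add: b_def binomial_fact field_simps)
    qed
    finally show ?thesis .
  qed
  have "(\<Sum>k=1..Suc m. b k) = b 1 + (\<Sum>k=2..Suc m. b k)"
    by (simp add: sum.atLeast_Suc_atMost numeral_2_eq_2)
  also have "(\<Sum>k=2..Suc m. b k) = B / 2 * (\<Sum>k=2..Suc m. \<Sum>j\<in>{1..<k}. b j * b (k - j))"
    by (subst sum_distrib_left, intro sum.cong refl rec) auto
  also have "(\<Sum>k=2..Suc m. \<Sum>j\<in>{1..<k}. b j * b (k - j))
      = (\<Sum>(k, j)\<in>(SIGMA k:{2..Suc m}. {1..<k}). b j * b (k - j))"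
    by (rule sum.Sigma) auto
  \<comment> \<open>The pairs \<open>(j, k - j)\<close> are distinct, and as their entries are
    positive with sum at most \<open>m + 1\<close>, they lie in the square of side
    \<open>m\<close>.\<close>
  also have "\<dots> = (\<Sum>(j, i)\<in>(\<lambda>(k, j). (j, k - j)) ` (SIGMA k:{2..Suc m}. {1..<k}). b j * b i)"
  proof -
    have "inj_on (\<lambda>(k, j). (j, k - j)) (SIGMA k:{2..Suc m}. {1..<k})"
      by (auto simp: inj_on_def)
    then show ?thesis by (simp add: sum.reindex o_def case_prod_unfold)
  qed
  also have "\<dots> \<le> (\<Sum>(j, i)\<in>{1..m} \<times> {1..m}. b j * b i)"
    by (intro sum_mono2) (auto simp: b_nonneg)
  also have "\<dots> = (\<Sum>k=1..m. b k)\<^sup>2"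
    by (simp add: sum.cartesian_product[symmetric] sum_product power2_eq_square)
  also have "\<dots> \<le> (1 / B)\<^sup>2"
    using Suc.IH b_nonneg by (intro power_mono sum_nonneg) (auto simp: b_def)
  finally have "(\<Sum>k=1..Suc m. b k) \<le> b 1 + B / 2 * (1 / B)\<^sup>2"
    using B by simp
  also have "\<dots> = 1 / B"
    using B by (simp add: b_def tree_bound.simps[of B "Suc 0"] power2_eq_square field_simps)
  finally show ?case by (simp add: b_def)
qed

theorem (in finite_percolation) cluster_tail_bound:
  assumes B: "\<And>w. w \<in> V \<Longrightarrow> (\<Sum>v\<in>V. pr (reach w v)) \<le> B" "B > 0" and "r \<in> V"
  shows "(exp (real n / (2 * B\<^sup>2)) - 1) * pr {\<omega>. n \<le> card {y \<in> V. linked (E \<omega>) V r y}} \<le> 1 / B"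
proof -
  define t where "t = real n / (2 * B\<^sup>2)"
  define p where "p = pr {\<omega>. n \<le> card {y \<in> V. linked (E \<omega>) V r y}}"
  have "(\<Sum>k=1..m. t ^ k / fact k) * p \<le> 1 / B" for m
  proof -
    have "(\<Sum>k=1..m. t ^ k / fact k) * p
        = (\<Sum>k=1..m. (real n ^ k * p) * (1 / (2 * B\<^sup>2)) ^ k / fact k)"
      by (simp add: sum_distrib_left sum_distrib_right t_def power_divide power_mult_distrib mult_ac)
    also have "\<dots> \<le> (\<Sum>k=1..m. tree_bound B k * (1 / (2 * B\<^sup>2)) ^ k / fact k)"
      unfolding p_def using assms
      by (intro sum_mono divide_right_mono mult_right_mono prob_cluster_moment_le) auto
    also have "\<dots> \<le> 1 / B" using B(2) by (rule tree_bound_partial_sum)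
    finally show ?thesis .
  qed
  moreover have "(\<lambda>m. (\<Sum>k=1..m. t ^ k / fact k) * p) \<longlonglongrightarrow> (exp t - 1) * p"
  proof -
    have "(\<lambda>k. t ^ k / fact k) sums exp t"
      using exp_converges[of t] by (simp add: divide_inverse mult.commute)
    then have "(\<lambda>m. \<Sum>k\<le>m. t ^ k / fact k) \<longlonglongrightarrow> exp t"
      by (simp add: sums_def_le)
    then have "(\<lambda>m. ((\<Sum>k\<le>m. t ^ k / fact k) - 1) * p) \<longlonglongrightarrow> (exp t - 1) * p"
      by (intro tendsto_intros)
    moreover have "(\<Sum>k\<le>m. t ^ k / fact k) - 1 = (\<Sum>k=1..m. t ^ k / fact k)" for m
      by (simp add: atMost_atLeast0 sum.atLeast_Suc_atMost)
    ultimately show ?thesis by simp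
  qed
  ultimately show ?thesis
    unfolding t_def p_def by (blast intro: LIMSEQ_le_const2)
qed

section \<open>Percolation on a regular graph\<close>

lemma Pi_pmf_resample:
  assumes "finite I" "w \<in> I"
  shows "Pi_pmf I dflt q = bind_pmf (Pi_pmf I dflt q) (\<lambda>\<omega>. map_pmf (\<lambda>s. (fun_upd \<omega> w s)) (q w))"
proof -
  have ins: "Pi_pmf I dflt q
      = do {y \<leftarrow> q w; f \<leftarrow> Pi_pmf (I - {w}) dflt q; return_pmf (fun_upd f w y)}"
    using Pi_pmf_insert'[of "I - {w}" w dflt q] assms by (simp add: insert_absorb)
  have "bind_pmf (Pi_pmf I dflt q) (\<lambda>\<omega>. map_pmf (\<lambda>s. (fun_upd \<omega> w s)) (q w))
      = do {f \<leftarrow> Pi_pmf (I - {w}) dflt q; s \<leftarrow> q w; return_pmf (fun_upd f w s)}"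
    by (simp add: ins bind_assoc_pmf bind_return_pmf map_pmf_def)
  also have "\<dots> = Pi_pmf I dflt q"
    unfolding ins by (rule bind_commute_pmf)
  finally show ?thesis by (rule sym)
qed

text \<open>The product law is stationary under resampling one state, so it suffices to look at the
  outcome after resampling at \<open>w\<close>. The event \<open>A\<close> may itself depend on the
  state of \<open>w\<close>.\<close>

lemma prob_resample:
  assumes "finite I" "w \<in> I" "c \<ge> 0"
    and "\<And>\<omega>. \<omega> \<in> A \<Longrightarrow> measure_pmf.prob (q w) {s. (fun_upd \<omega> w s) \<in> B} \<ge> c"
  shows "c * measure_pmf.prob (Pi_pmf I dflt q) A \<le> measure_pmf.prob (Pi_pmf I dflt q) B"
proof -
  let ?P = "Pi_pmf I dflt q"
  have "ennreal (c * measure_pmf.prob ?P A) = (\<integral>\<^sup>+\<omega>. ennreal c * indicator A \<omega> \<partial>?P)"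
    using assms(3) by (simp add: nn_integral_cmult_indicator ennreal_mult measure_pmf.emeasure_eq_measure)
  also have "\<dots> \<le> (\<integral>\<^sup>+\<omega>. emeasure (map_pmf (\<lambda>s. (fun_upd \<omega> w s)) (q w)) B \<partial>?P)"
  proof (rule nn_integral_mono)
    fix \<omega>
    show "ennreal c * indicator A \<omega> \<le> emeasure (map_pmf (\<lambda>s. (fun_upd \<omega> w s)) (q w)) B"
      using assms(4)[of \<omega>]
      by (auto simp: indicator_def measure_pmf.emeasure_eq_measure vimage_def simp del: map_pmf_rep_eq
          intro!: ennreal_leI)
  qed
  also have "\<dots> = emeasure ?P B"
    by (subst (2) Pi_pmf_resample[OF assms(1,2)]) (simp only: emeasure_bind_pmf)
  finally show ?thesis by (simp add: measure_pmf.emeasure_eq_measure)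
qed

lemma sum_supersets_card:
  fixes g :: "nat \<Rightarrow> real"
  assumes "finite L" "T \<subseteq> L"
  shows "(\<Sum>S | T \<subseteq> S \<and> S \<subseteq> L. g (card S))
    = (\<Sum>i=card T..card L. real ((card L - card T) choose (i - card T)) * g i)"
proof -
  have T: "finite T" using assms finite_subset by blast
  have "(\<Sum>S | T \<subseteq> S \<and> S \<subseteq> L. g (card S)) = (\<Sum>S\<in>Pow (L - T). g (card S + card T))"
  proof (rule sum.reindex_bij_witness[where i = "\<lambda>S. S \<union> T" and j = "\<lambda>S. S - T"])
    fix S assume "S \<in> {S. T \<subseteq> S \<and> S \<subseteq> L}"
    then show "g (card (S - T) + card T) = g (card S)"
      using T card_mono[of S T] finite_subset[OF _ assms(1), of S] by (simp add: card_Diff_subset)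
  qed (use assms in auto)
  also have "\<dots> = (\<Sum>j\<le>card L - card T. real ((card L - card T) choose j) * g (j + card T))"
    using sum_Pow_card[of "L - T" "\<lambda>j. g (j + card T)"] assms T by (simp add: card_Diff_subset)
  also have "\<dots> = (\<Sum>i=card T..card L. real ((card L - card T) choose (i - card T)) * g i)"
    using card_mono[OF assms]
    by (intro sum.reindex_bij_witness[where i = "\<lambda>i. i - card T" and j = "\<lambda>j. j + card T"]) auto
  finally show ?thesis .
qed

text \<open>The probability that two given neighbours both belong to the state of a vertex; the last
  factor of \<open>strong_c\<close>.\<close>

definition strong_c2 :: "(nat \<Rightarrow> real) \<Rightarrow> nat \<Rightarrow> real" where
  "strong_c2 p d = (\<Sum>i=2..d. p i * (real i * (real i - 1) / (real d * (real d - 1))))"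

text \<open>Both kinds of connection at once: \<open>op\<close> combines the two directions of an
  edge, by disjunction in the weak and by conjunction in the strong case.\<close>

locale regular_percolation = transitive_regular_digraph G root d
  for G :: "'v pair_pre_digraph" and root :: 'v and d :: nat +
  fixes p :: "nat \<Rightarrow> real" and op :: "bool \<Rightarrow> bool \<Rightarrow> bool"
  assumes p_nonneg: "i \<le> d \<Longrightarrow> 0 \<le> p i"
    and p_sum: "(\<Sum>i\<le>d. p i) = 1"
    and op_mono: "op a b \<Longrightarrow> (a \<Longrightarrow> a') \<Longrightarrow> (b \<Longrightarrow> b') \<Longrightarrow> op a' b'"
begin

lemma nbrs_finite [simp]: "x \<in> pverts G \<Longrightarrow> finite (nbrs G x)"
  and card_nbrs [simp]: "x \<in> pverts G \<Longrightarrow> card (nbrs G x) = d"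
  using regular by auto

lemma arcs_sym: "(x, y) \<in> parcs G \<Longrightarrow> (y, x) \<in> parcs G"
  using pair_sym_arcs by (auto simp: symmetric_def dest: symD)

lemma arcs_in_verts: "(x, y) \<in> parcs G \<Longrightarrow> x \<in> pverts G \<and> y \<in> pverts G"
  by (auto dest: in_arcsD1 in_arcsD2)

lemma arcs_loopfree: "(x, y) \<in> parcs G \<Longrightarrow> x \<noteq> y"
  using pair_no_loops by force

section \<open>The law of a single state\<close>

definition weight :: "'v set \<Rightarrow> real" where
  "weight S = p (card S) / real (d choose card S)"

lemma weight_nonneg: "x \<in> pverts G \<Longrightarrow> S \<subseteq> nbrs G x \<Longrightarrow> 0 \<le> weight S"
  using card_mono[of "nbrs G x" S] by (simp add: weight_def p_nonneg)

lemma sum_weight: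
  assumes "x \<in> pverts G" "T \<subseteq> nbrs G x"
  shows "(\<Sum>S | T \<subseteq> S \<and> S \<subseteq> nbrs G x. weight S)
    = (\<Sum>i=card T..d. real ((d - card T) choose (i - card T)) * (p i / real (d choose i)))"
  unfolding weight_def
  using sum_supersets_card[of "nbrs G x" T "\<lambda>i. p i / real (d choose i)"] assms by simp

lemma sum_weight_1: "x \<in> pverts G \<Longrightarrow> (\<Sum>S\<in>Pow (nbrs G x). weight S) = 1"
proof -
  assume "x \<in> pverts G"
  then have "(\<Sum>S | {} \<subseteq> S \<and> S \<subseteq> nbrs G x. weight S) = (\<Sum>i\<le>d. p i)"
    by (subst sum_weight) (auto simp: atMost_atLeast0 intro!: sum.cong)
  then show ?thesis by (simp add: p_sum Pow_def)
qed

definition state :: "'v \<Rightarrow> 'v set pmf" where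
  "state x = embed_pmf (\<lambda>S. if S \<subseteq> nbrs G x then weight S else 0)"

lemma pmf_state:
  assumes "x \<in> pverts G"
  shows "pmf (state x) S = (if S \<subseteq> nbrs G x then weight S else 0)"
  unfolding state_def
proof (rule pmf_embed_pmf)
  have "(\<integral>\<^sup>+S. ennreal (if S \<subseteq> nbrs G x then weight S else 0) \<partial>count_space UNIV)
      = (\<integral>\<^sup>+S. ennreal (if S \<subseteq> nbrs G x then weight S else 0) \<partial>count_space (Pow (nbrs G x)))"
    by (intro nn_integral_count_space_eq) auto
  also have "\<dots> = (\<Sum>S\<in>Pow (nbrs G x). ennreal (weight S))"
    using assms by (subst nn_integral_count_space_finite) auto
  also have "\<dots> = 1"
    using assms by (subst sum_ennreal) (auto simp: sum_weight_1 weight_nonneg)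
  finally show "(\<integral>\<^sup>+S. ennreal (if S \<subseteq> nbrs G x then weight S else 0) \<partial>count_space UNIV) = 1" .
qed (use assms in \<open>auto simp: weight_nonneg\<close>)

lemma set_pmf_state: "x \<in> pverts G \<Longrightarrow> set_pmf (state x) \<subseteq> Pow (nbrs G x)"
  by (auto simp: set_pmf_eq pmf_state split: if_splits)

lemma prob_state_superset:
  assumes "x \<in> pverts G" "T \<subseteq> nbrs G x"
  shows "measure_pmf.prob (state x) {S. T \<subseteq> S}
    = (\<Sum>i=card T..d. real ((d - card T) choose (i - card T)) * (p i / real (d choose i)))"
proof -
  have "measure_pmf.prob (state x) {S. T \<subseteq> S} = measure_pmf.prob (state x) {S. T \<subseteq> S \<and> S \<subseteq> nbrs G x}"
    using assms by (intro measure_prob_cong_0) (auto simp: pmf_state)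
  also have "\<dots> = (\<Sum>S | T \<subseteq> S \<and> S \<subseteq> nbrs G x. weight S)"
    using assms by (subst measure_measure_pmf_finite)
      (auto simp: pmf_state intro: finite_subset[of _ "Pow (nbrs G x)"])
  finally show ?thesis using sum_weight[OF assms] by simp
qed

text \<open>A given neighbour lies in a fraction i/d of the i-element subsets; this is the origin of
  the sum \<open>weak_c\<close>.\<close>

lemma prob_state_member:
  assumes "x \<in> pverts G" "y \<in> nbrs G x"
  shows "measure_pmf.prob (state x) {S. y \<in> S} = weak_c p d"
proof -
  have "measure_pmf.prob (state x) {S. y \<in> S}
      = (\<Sum>i=1..d. real ((d - 1) choose (i - 1)) * (p i / real (d choose i)))"
    using prob_state_superset[of x "{y}"] assms by simp
  also have "\<dots> = weak_c p d"
    unfolding weak_c_def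
  proof (intro sum.cong refl)
    fix i assume i: "i \<in> {1..d}"
    then have "real i * real (d choose i) = real d * real ((d - 1) choose (i - 1))"
      using binomial_absorption[of "i - 1" d] by (simp flip: of_nat_mult)
    moreover have "real (d choose i) > 0" "real d > 0" using i by auto
    ultimately show "real ((d - 1) choose (i - 1)) * (p i / real (d choose i)) = p i * (real i / real d)"
      by (simp add: field_simps)
  qed
  finally show ?thesis .
qed

lemma prob_state_two_members:
  assumes "x \<in> pverts G" "y \<in> nbrs G x" "z \<in> nbrs G x" "y \<noteq> z"
  shows "measure_pmf.prob (state x) {S. y \<in> S \<and> z \<in> S} = strong_c2 p d"
proof -
  have "measure_pmf.prob (state x) {S. y \<in> S \<and> z \<in> S}
      = (\<Sum>i=2..d. real ((d - 2) choose (i - 2)) * (p i / real (d choose i)))"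
    using prob_state_superset[of x "{y, z}"] assms by (simp add: numeral_2_eq_2)
  also have "\<dots> = strong_c2 p d"
    unfolding strong_c2_def
  proof (intro sum.cong refl)
    fix i assume i: "i \<in> {2..d}"
    define j e where "j = i - 2" and "e = d - 2"
    with i have ij: "i = Suc (Suc j)" "d = Suc (Suc e)" "j \<le> e" by auto
    have "i * (d choose i) = d * (Suc e choose Suc j)"
      using binomial_absorption[of "Suc j" "Suc (Suc e)"] unfolding ij(1,2) by (simp only: diff_Suc_1)
    then have "real i * real (d choose i) = real d * real (Suc e choose Suc j)"
      by (metis of_nat_mult)
    moreover have "Suc j * (Suc e choose Suc j) = Suc e * (e choose j)"
      using binomial_absorption[of j "Suc e"] by (simp only: diff_Suc_1)
    then have "(real i - 1) * real (Suc e choose Suc j) = (real d - 1) * real (e choose j)"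
      unfolding ij(1,2) by (metis add_diff_cancel_left' of_nat_Suc of_nat_mult)
    ultimately have "(real i * (real i - 1)) * real (d choose i) = real d * (real d - 1) * real (e choose j)"
      by (metis mult.assoc mult.commute)
    moreover have "real (d choose i) > 0" using i by auto
    moreover have "real d * (real d - 1) > 0" using ij by auto
    moreover have "W * (x / C) = x * (a / D)" if "a * C = D * W" "C > 0" "D > 0" for a C D W x :: real
      using that by (simp add: field_simps)
    ultimately show "real ((d - 2) choose (i - 2)) * (p i / real (d choose i))
        = p i * (real i * (real i - 1) / (real d * (real d - 1)))"
      unfolding j_def e_def by blast
  qed
  finally show ?thesis .
qed

definition edges :: "('v \<Rightarrow> 'v set) \<Rightarrow> 'v rel" where
  "edges \<omega> = {(x, y) \<in> parcs G. op (y \<in> \<omega> x) (x \<in> \<omega> y)}"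

definition cluster :: "'v \<Rightarrow> ('v \<Rightarrow> 'v set) \<Rightarrow> 'v set" where
  "cluster x \<omega> = {y. (x, y) \<in> (edges \<omega>)\<^sup>*}"

lemma finite_percolation_edges: "finite \<Lambda> \<Longrightarrow> finite_percolation \<Lambda> (parcs G) edges"
  by unfold_locales (auto simp: edges_def)

abbreviation prob_on :: "'v set \<Rightarrow> ('v \<Rightarrow> 'v set) set \<Rightarrow> real" where
  "prob_on \<Lambda> \<equiv> measure_pmf.prob (Pi_pmf \<Lambda> {} state)"

abbreviation conn_prob :: "'v set \<Rightarrow> 'v \<Rightarrow> 'v \<Rightarrow> real" where
  "conn_prob \<Lambda> x y \<equiv> prob_on \<Lambda> {\<omega>. linked (edges \<omega>) \<Lambda> x y}"

lemma edges_cong: "(\<And>x. x \<in> K \<Longrightarrow> \<omega> x = \<eta> x) \<Longrightarrow> edges \<omega> \<inter> K \<times> K = edges \<eta> \<inter> K \<times> K"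
  by (auto simp: edges_def)

lemma linked_edges_cong:
  assumes "\<And>x. x \<in> K \<Longrightarrow> \<omega> x = \<eta> x"
  shows "linked (edges \<omega>) K x y \<longleftrightarrow> linked (edges \<eta>) K x y"
  using edges_cong[of K \<omega> \<eta>] assms by (simp add: linked_def)

text \<open>With degree at most 1 a path from the root can only go to its single neighbour and back,
  so a connected graph would be finite.\<close>

lemma degree_ge_2: "d \<ge> 2"
proof (rule ccontr)
  assume "\<not> d \<ge> 2"
  let ?S = "insert root (nbrs G root)"
  have eq: "y = z" if "y \<in> nbrs G x" "z \<in> nbrs G x" "x \<in> pverts G" for x y z
    using that regular[of x] \<open>\<not> d \<ge> 2\<close> card_le_Suc0_iff_eq[of "nbrs G x"] by auto
  have "y \<in> ?S" if "(root, y) \<in> rtrancl_on (pverts G) (parcs G)" for y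
    using that
  proof (induction rule: rtrancl_on_induct)
    case (step y z)
    show ?case
    proof (cases "y = root")
      case False
      with step have "(y, root) \<in> parcs G" by (auto intro: arcs_sym)
      with step show ?thesis using eq[of root y z] by auto
    qed (use step in auto)
  qed auto
  moreover have "(root, y) \<in> rtrancl_on (pverts G) (parcs G)" if "y \<in> pverts G" for y
    using connected that root_in_verts adj_mk_symmetric_eq[OF pair_sym_arcs]
    by (auto simp: connected_def strongly_connected_def reachable_def)
  ultimately have "pverts G \<subseteq> ?S" by blast
  moreover have "finite ?S" using root_in_verts by simp
  ultimately show False using infinite_verts finite_subset by blast
qed

end

section \<open>The infinite product measure and its finite-volume marginals\<close>

context regular_percolation
begin

lemma space_perc: "space (perc G d p) = (\<Pi>\<^sub>E x\<in>pverts G. Pow (nbrs G x))"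
  by (simp add: perc_def space_PiM space_point_measure)

lemma emeasure_state_measure:
  assumes "x \<in> pverts G" "S \<subseteq> nbrs G x"
  shows "emeasure (point_measure (Pow (nbrs G x)) (\<lambda>S. ennreal (p (card S) / real (d choose card S)))) {S}
    = ennreal (pmf (state x) S)"
  using assms by (subst emeasure_point_measure_finite) (auto simp: pmf_state weight_def)

lemma prob_space_state_measure:
  assumes "x \<in> pverts G"
  shows "prob_space (point_measure (Pow (nbrs G x)) (\<lambda>S. ennreal (p (card S) / real (d choose card S))))"
proof (rule prob_spaceI)
  have "(\<Sum>S\<in>Pow (nbrs G x). ennreal (weight S)) = 1"
    using assms by (subst sum_ennreal) (auto simp: sum_weight_1 weight_nonneg)
  then show "emeasure (point_measure (Pow (nbrs G x)) (\<lambda>S. ennreal (p (card S) / real (d choose card S))))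
      (space (point_measure (Pow (nbrs G x)) (\<lambda>S. ennreal (p (card S) / real (d choose card S))))) = 1"
    using assms by (simp add: space_point_measure emeasure_point_measure_finite weight_def)
qed

lemma prob_space_perc: "prob_space (perc G d p)"
  unfolding perc_def by (intro prob_space_PiM prob_space_state_measure)

lemma perc_cylinder:
  assumes "finite \<Lambda>" "\<Lambda> \<subseteq> pverts G" "\<And>x. x \<in> \<Lambda> \<Longrightarrow> \<eta> x \<subseteq> nbrs G x"
  shows "{\<omega> \<in> space (perc G d p). \<forall>x\<in>\<Lambda>. \<omega> x \<in> {\<eta> x}} \<in> sets (perc G d p)" (is ?sets)
    and "measure (perc G d p) {\<omega> \<in> space (perc G d p). \<forall>x\<in>\<Lambda>. \<omega> x \<in> {\<eta> x}}
      = (\<Prod>x\<in>\<Lambda>. pmf (state x) (\<eta> x))" (is ?meas)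
proof -
  \<comment> \<open>The product locale asks for a probability measure at every index, so indices
    outside the graph get a point mass; the product over the vertices is unchanged.\<close>
  define N where "N x = (if x \<in> pverts G
    then point_measure (Pow (nbrs G x)) (\<lambda>S. ennreal (p (card S) / real (d choose card S)))
    else return (count_space UNIV) {})" for x
  have perc: "perc G d p = PiM (pverts G) N"
    unfolding perc_def by (rule PiM_cong) (auto simp: N_def)
  have N: "prob_space (N x)" for x
    by (auto simp: N_def prob_space_state_measure intro: prob_space_return)
  interpret product_prob_space N "pverts G"
    using N by (rule product_prob_spaceI)
  have sets: "{\<eta> x} \<in> sets (N x)" if "x \<in> \<Lambda>" for x
    using that assms by (auto simp: N_def sets_point_measure)
  show ?sets
    unfolding perc
  proof (intro sets.sets_Collect_finite_All assms(1))
    fix x assume x: "x \<in> \<Lambda>"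
    have "(\<lambda>\<omega>. \<omega> x) -` {\<eta> x} \<inter> space (PiM (pverts G) N) \<in> sets (PiM (pverts G) N)"
      using x assms(2) sets by (intro measurable_sets[OF measurable_component_singleton]) auto
    moreover have "(\<lambda>\<omega>. \<omega> x) -` {\<eta> x} \<inter> space (PiM (pverts G) N)
        = {\<omega> \<in> space (PiM (pverts G) N). \<omega> x \<in> {\<eta> x}}" by auto
    ultimately show "{\<omega> \<in> space (PiM (pverts G) N). \<omega> x \<in> {\<eta> x}} \<in> sets (PiM (pverts G) N)" by simp
  qed
  have "emeasure (perc G d p) {\<omega> \<in> space (perc G d p). \<forall>x\<in>\<Lambda>. \<omega> x \<in> {\<eta> x}}
      = (\<Prod>x\<in>\<Lambda>. emeasure (N x) {\<eta> x})"
    unfolding perc using assms sets by (intro emeasure_PiM_Collect) auto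
  also have "\<dots> = (\<Prod>x\<in>\<Lambda>. ennreal (pmf (state x) (\<eta> x)))"
    using assms by (intro prod.cong refl) (auto simp: N_def emeasure_state_measure)
  finally show ?meas
    by (simp add: measure_def prod_ennreal prod_nonneg)
qed

text \<open>Such an event is a finite disjoint union of cylinders, one for each pattern on
  \<open>\<Lambda>\<close>. This is the bridge from \<open>perc\<close> to the discrete
  finite-volume laws.\<close>

lemma perc_local_event:
  assumes "finite \<Lambda>" "\<Lambda> \<subseteq> pverts G"
    and A: "\<And>\<omega> \<eta>. (\<And>x. x \<in> \<Lambda> \<Longrightarrow> \<omega> x = \<eta> x) \<Longrightarrow> \<omega> \<in> A \<Longrightarrow> \<eta> \<in> A"
  shows "{\<omega> \<in> space (perc G d p). \<omega> \<in> A} \<in> sets (perc G d p)" (is ?sets)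
    and "measure (perc G d p) {\<omega> \<in> space (perc G d p). \<omega> \<in> A} = prob_on \<Lambda> A" (is ?meas)
proof -
  interpret P: prob_space "perc G d p" by (rule prob_space_perc)
  define F where "F = PiE_dflt \<Lambda> {} (\<lambda>x. Pow (nbrs G x)) \<inter> A"
  define C where "C \<eta> = {\<omega> \<in> space (perc G d p). \<forall>x\<in>\<Lambda>. \<omega> x \<in> {\<eta> x}}" for \<eta>
  have fin: "finite F"
    unfolding F_def using assms by (intro finite_Int disjI1 finite_PiE_dflt) auto
  have F: "\<eta> x \<subseteq> nbrs G x" if "\<eta> \<in> F" "x \<in> \<Lambda>" for \<eta> x
    using that by (auto simp: F_def PiE_dflt_def)
  have C: "C \<eta> \<in> sets (perc G d p)" "measure (perc G d p) (C \<eta>) = pmf (Pi_pmf \<Lambda> {} state) \<eta>"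
    if "\<eta> \<in> F" for \<eta>
  proof -
    have "pmf (Pi_pmf \<Lambda> {} state) \<eta> = (\<Prod>x\<in>\<Lambda>. pmf (state x) (\<eta> x))"
      using that assms(1) by (intro pmf_Pi') (auto simp: F_def PiE_dflt_def)
    then show "C \<eta> \<in> sets (perc G d p)" "measure (perc G d p) (C \<eta>) = pmf (Pi_pmf \<Lambda> {} state) \<eta>"
      using perc_cylinder[OF assms(1,2) F[OF that]] by (simp_all add: C_def)
  qed
  have eq: "{\<omega> \<in> space (perc G d p). \<omega> \<in> A} = (\<Union>\<eta>\<in>F. C \<eta>)"
  proof (intro equalityI subsetI)
    fix \<omega> assume \<omega>: "\<omega> \<in> {\<omega> \<in> space (perc G d p). \<omega> \<in> A}"
    let ?\<eta> = "\<lambda>x. if x \<in> \<Lambda> then \<omega> x else {}"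
    have "?\<eta> \<in> A" using \<omega> by (intro A[of \<omega> ?\<eta>]) auto
    then have "?\<eta> \<in> F" using \<omega> assms(2) by (auto simp: F_def PiE_dflt_def space_perc)
    with \<omega> show "\<omega> \<in> (\<Union>\<eta>\<in>F. C \<eta>)" by (auto simp: C_def intro!: bexI[of _ ?\<eta>])
  next
    fix \<omega> assume "\<omega> \<in> (\<Union>\<eta>\<in>F. C \<eta>)"
    then obtain \<eta> where "\<eta> \<in> F" "\<omega> \<in> C \<eta>" by blast
    then show "\<omega> \<in> {\<omega> \<in> space (perc G d p). \<omega> \<in> A}"
      using A[of \<eta> \<omega>] by (auto simp: C_def F_def)
  qed
  show ?sets unfolding eq using fin C by auto
  have "disjoint_family_on C F"
    by (fastforce simp: disjoint_family_on_def C_def F_def PiE_dflt_def fun_eq_iff)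
  then have "measure (perc G d p) (\<Union>\<eta>\<in>F. C \<eta>) = (\<Sum>\<eta>\<in>F. measure (perc G d p) (C \<eta>))"
    using fin C by (intro P.finite_measure_finite_Union) auto
  also have "\<dots> = (\<Sum>\<eta>\<in>F. pmf (Pi_pmf \<Lambda> {} state) \<eta>)"
    using C by (intro sum.cong) auto
  also have "\<dots> = prob_on \<Lambda> F"
    using fin by (simp add: measure_measure_pmf_finite)
  also have "\<dots> = prob_on \<Lambda> A"
  proof (rule measure_prob_cong_0)
    fix \<eta> assume "\<eta> \<in> A - F"
    then show "pmf (Pi_pmf \<Lambda> {} state) \<eta> = 0"
      using assms(1,2) set_pmf_state set_Pi_pmf_subset'[OF assms(1), of "{}" state]
      by (fastforce simp: F_def PiE_dflt_def pmf_eq_0_set_pmf)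
  qed (auto simp: F_def)
  finally show ?meas by (simp add: eq)
qed

section \<open>Mean cluster size and transitivity\<close>

definition chi :: ennreal where
  "chi = (\<integral>\<^sup>+\<omega>. num (cluster root \<omega>) \<partial>perc G d p)"

lemma linked_imp_cluster: "linked (edges \<omega>) K x y \<Longrightarrow> y \<in> cluster x \<omega>"
  using linked_mono[of "edges \<omega>" K x y "edges \<omega>" UNIV] by (auto simp: linked_def cluster_def)

lemma sum_conn_prob_root_le:
  assumes "finite \<Lambda>" "\<Lambda> \<subseteq> pverts G"
  shows "ennreal (\<Sum>y\<in>\<Lambda>. conn_prob \<Lambda> root y) \<le> chi"
proof -
  interpret P: prob_space "perc G d p" by (rule prob_space_perc)
  let ?A = "\<lambda>y. {\<omega> \<in> space (perc G d p). \<omega> \<in> {\<omega>. linked (edges \<omega>) \<Lambda> root y}}"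
  have loc: "\<eta> \<in> {\<omega>. linked (edges \<omega>) \<Lambda> root y}"
    if "\<And>x. x \<in> \<Lambda> \<Longrightarrow> \<omega> x = \<eta> x" "\<omega> \<in> {\<omega>. linked (edges \<omega>) \<Lambda> root y}" for \<omega> \<eta> y
    using that linked_edges_cong[of \<Lambda> \<omega> \<eta>] by auto
  have A: "?A y \<in> sets (perc G d p)" "P.prob (?A y) = conn_prob \<Lambda> root y" for y
    by (rule perc_local_event[OF assms loc]; assumption)+
  have "ennreal (\<Sum>y\<in>\<Lambda>. conn_prob \<Lambda> root y) = (\<Sum>y\<in>\<Lambda>. emeasure (perc G d p) (?A y))"
    unfolding A(2)[symmetric] P.emeasure_eq_measure by (simp add: sum_ennreal)
  also have "\<dots> = (\<integral>\<^sup>+\<omega>. (\<Sum>y\<in>\<Lambda>. indicator (?A y) \<omega>) \<partial>perc G d p)"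
    using A(1) by (simp add: nn_integral_sum)
  also have "\<dots> \<le> chi"
    unfolding chi_def
  proof (rule nn_integral_mono)
    fix \<omega>
    have "(\<Sum>y\<in>\<Lambda>. indicator (?A y) \<omega> :: ennreal)
        \<le> (\<Sum>y\<in>\<Lambda>. indicator {y. linked (edges \<omega>) \<Lambda> root y} y)"
      by (intro sum_mono) (auto simp: indicator_def)
    also have "\<dots> = num {y \<in> \<Lambda>. linked (edges \<omega>) \<Lambda> root y}"
      using assms(1) by (simp add: indicator_def sum.If_cases Int_def)
    also have "\<dots> \<le> num (cluster root \<omega>)"
      by (intro emeasure_mono) (auto intro: linked_imp_cluster)
    finally show "(\<Sum>y\<in>\<Lambda>. indicator (?A y) \<omega>) \<le> num (cluster root \<omega>)" .
  qed
  finally show ?thesis .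
qed

text \<open>The isomorphism acts on vertices and arcs separately. As it fixes the graph, its tail
  and head maps are the projections, so arcs move with their endpoints. The resulting inclusion of
  neighbourhoods is an equality because both have \<open>d\<close> elements.\<close>

lemma automorphism_exists:
  assumes "w \<in> pverts G"
  obtains f where "bij_betw f (pverts G) (pverts G)" "f w = root"
    "\<And>x. x \<in> pverts G \<Longrightarrow> nbrs G (f x) = f ` nbrs G x"
proof -
  obtain F where F: "pre_digraph.digraph_isomorphism (with_proj G) F"
    "app_iso F (with_proj G) = with_proj G" "iso_verts F w = root"
    using transitive assms root_in_verts unfolding vertex_transitive_def by blast
  let ?f = "iso_verts F"
  have inj: "inj_on ?f (pverts G)"
    using F(1) by (simp add: pre_digraph.digraph_isomorphism_def)
  have img: "?f ` pverts G = pverts G" and img_arcs: "iso_arcs F ` parcs G = parcs G"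
    and tl: "iso_tail F = fst" and hd: "iso_head F = snd"
    using arg_cong[OF F(2), of verts] arg_cong[OF F(2), of arcs]
      arg_cong[OF F(2), of tail] arg_cong[OF F(2), of head] by simp_all
  have arc: "(?f x, ?f y) \<in> parcs G" if "(x, y) \<in> parcs G" for x y
  proof -
    have "fst (iso_arcs F (x, y)) = ?f x" "snd (iso_arcs F (x, y)) = ?f y"
      using F(1) that tl hd by (auto simp: pre_digraph.digraph_isomorphism_def)
    moreover have "iso_arcs F (x, y) \<in> parcs G" using img_arcs that by blast
    ultimately show ?thesis by (metis prod.collapse)
  qed
  have "nbrs G (?f x) = ?f ` nbrs G x" if x: "x \<in> pverts G" for x
  proof -
    have fx: "?f x \<in> pverts G" using img x by blast
    have "inj_on ?f (nbrs G x)" using inj by (rule inj_on_subset) (auto dest: arcs_in_verts)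
    then have "card (?f ` nbrs G x) = d" using x by (simp add: card_image)
    with fx have "?f ` nbrs G x = nbrs G (?f x)"
      by (intro card_subset_eq) (auto simp: arc)
    then show ?thesis by simp
  qed
  with inj img F(3) show thesis by (intro that[of ?f]) (auto simp: bij_betw_def)
qed

lemma map_state_automorphism:
  assumes f: "bij_betw f (pverts G) (pverts G)"
    "\<And>x. x \<in> pverts G \<Longrightarrow> nbrs G (f x) = f ` nbrs G x" and x: "x \<in> pverts G"
  shows "map_pmf (image f) (state x) = state (f x)"
proof (rule pmf_eqI)
  fix S
  have sub: "nbrs G x \<subseteq> pverts G" by (auto dest: arcs_in_verts)
  have inj: "inj_on f (pverts G)" and fx: "f x \<in> pverts G" using f x by (auto simp: bij_betw_def)
  have inj_img: "inj_on (image f) (set_pmf (state x))"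
    using inj_on_image_Pow[OF inj] by (rule inj_on_subset) (use set_pmf_state[OF x] sub in auto)
  have wt: "pmf (state (f x)) (f ` T) = pmf (state x) T" if "T \<subseteq> nbrs G x" for T
  proof -
    have "card (f ` T) = card T" using that sub inj by (intro card_image) (auto intro: inj_on_subset)
    moreover have "f ` T \<subseteq> nbrs G (f x)" using f(2)[OF x] that by auto
    ultimately show ?thesis using that x fx by (simp add: pmf_state weight_def)
  qed
  show "pmf (map_pmf (image f) (state x)) S = pmf (state (f x)) S"
  proof (cases "S \<in> image f ` set_pmf (state x)")
    case True
    then obtain T where T: "T \<in> set_pmf (state x)" "S = f ` T" by blast
    then show ?thesis using inj_img wt[of T] set_pmf_state[OF x] by (auto simp: pmf_map_inj)
  next
    case False
    have "pmf (state (f x)) S = 0"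
    proof (cases "S \<subseteq> nbrs G (f x)")
      case True
      then obtain T where T: "T \<subseteq> nbrs G x" "S = f ` T"
        unfolding f(2)[OF x] by (metis subset_imageE)
      with False have "T \<notin> set_pmf (state x)" by blast
      with T wt[of T] show ?thesis by (simp add: pmf_eq_0_set_pmf)
    qed (use fx in \<open>simp add: pmf_state\<close>)
    with False show ?thesis by (simp add: pmf_map_outside)
  qed
qed

lemma conn_prob_automorphism:
  assumes f: "bij_betw f (pverts G) (pverts G)"
    "\<And>x. x \<in> pverts G \<Longrightarrow> nbrs G (f x) = f ` nbrs G x"
    and \<Lambda>: "finite \<Lambda>" "\<Lambda> \<subseteq> pverts G"
  shows "conn_prob \<Lambda> w v \<le> conn_prob (f ` \<Lambda>) (f w) (f v)"
proof -
  define g where "g = inv_into (pverts G) f"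
  \<comment> \<open>The state of \<open>y\<close> is transported from its preimage; off the vertex
    set the value is the default of \<open>Pi_pmf\<close>, so that \<open>T\<close> maps
    finite-volume laws to finite-volume laws.\<close>
  define T where "T \<omega> y = (if y \<in> pverts G then f ` \<omega> (g y) else {})" for \<omega> y
  have inj: "inj_on f (pverts G)" and img: "f ` pverts G = pverts G"
    using f(1) by (auto simp: bij_betw_def)
  have g: "g (f x) = x" if "x \<in> pverts G" for x using inj that by (simp add: g_def)
  have g': "g y \<in> pverts G" "f (g y) = y" if "y \<in> pverts G" for y
    using that img unfolding g_def by (metis inv_into_into f_inv_into_f)+
  have "map_pmf T (Pi_pmf \<Lambda> {} state) = Pi_pmf (f ` \<Lambda>) {} state"
    using \<Lambda>
  proof (induction \<Lambda> rule: finite_induct)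
    case empty
    then show ?case by (simp add: T_def fun_eq_iff)
  next
    case (insert x \<Lambda>)
    then have x: "x \<in> pverts G" and fx: "f x \<notin> f ` \<Lambda>"
      using inj by (auto simp: inj_on_def)
    have upd: "T (fun_upd \<omega> x s) = fun_upd (T \<omega>) (f x) (f ` s)" for \<omega> s
      using x g g' img by (auto simp: T_def fun_eq_iff)
    have "map_pmf T (Pi_pmf (insert x \<Lambda>) {} state)
        = map_pmf (\<lambda>(y, h). fun_upd h (f x) y)
            (map_pmf (\<lambda>(a, b). (f ` a, T b)) (pair_pmf (state x) (Pi_pmf \<Lambda> {} state)))"
      using insert by (simp add: Pi_pmf_insert map_pmf_comp case_prod_unfold upd)
    also have "\<dots> = map_pmf (\<lambda>(y, h). fun_upd h (f x) y)
        (pair_pmf (state (f x)) (Pi_pmf (f ` \<Lambda>) {} state))"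
      using insert map_state_automorphism[OF f x] by (simp add: map_pair)
    also have "\<dots> = Pi_pmf (f ` insert x \<Lambda>) {} state"
      using insert fx by (simp add: Pi_pmf_insert)
    finally show ?case .
  qed
  then have "conn_prob (f ` \<Lambda>) (f w) (f v) = prob_on \<Lambda> {\<omega>. linked (edges (T \<omega>)) (f ` \<Lambda>) (f w) (f v)}"
    by (simp only: flip: \<open>map_pmf T (Pi_pmf \<Lambda> {} state) = Pi_pmf (f ` \<Lambda>) {} state\<close>)
      (simp only: measure_map_pmf vimage_Collect_eq)
  moreover have "linked (edges (T \<omega>)) (f ` \<Lambda>) (f w) (f v)" if "linked (edges \<omega>) \<Lambda> w v" for \<omega>
    using that unfolding linked_def[of _ \<Lambda>]
  proof (induction rule: rtrancl_induct)
    case (step y z)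
    then have yz: "y \<in> pverts G" "z \<in> pverts G" "f y \<in> pverts G" "f z \<in> pverts G"
      using \<Lambda>(2) img by auto
    have arc: "(y, z) \<in> parcs G" "op (z \<in> \<omega> y) (y \<in> \<omega> z)"
      using step by (auto simp: edges_def)
    have "f z \<in> nbrs G (f y)" using f(2)[OF yz(1)] arc by auto
    moreover have "op (f z \<in> T \<omega> (f y)) (f y \<in> T \<omega> (f z))"
      using arc(2) by (rule op_mono) (use yz g in \<open>auto simp: T_def\<close>)
    ultimately have "(f y, f z) \<in> edges (T \<omega>)" by (simp add: edges_def)
    with step show ?case by (intro linked_step[OF step.IH]) auto
  qed simp
  then have "prob_on \<Lambda> {\<omega>. linked (edges \<omega>) \<Lambda> w v}
      \<le> prob_on \<Lambda> {\<omega>. linked (edges (T \<omega>)) (f ` \<Lambda>) (f w) (f v)}"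
    by (intro measure_pmf.finite_measure_mono) auto
  ultimately show ?thesis by simp
qed

text \<open>An automorphism taking \<open>w\<close> to the root also moves the volume, which is
  harmless because the bound at the root holds in every finite volume.\<close>

lemma sum_conn_prob_le:
  assumes "finite \<Lambda>" "\<Lambda> \<subseteq> pverts G" "w \<in> \<Lambda>"
  shows "ennreal (\<Sum>v\<in>\<Lambda>. conn_prob \<Lambda> w v) \<le> chi"
proof -
  obtain f where f: "bij_betw f (pverts G) (pverts G)" "f w = root"
    "\<And>x. x \<in> pverts G \<Longrightarrow> nbrs G (f x) = f ` nbrs G x"
    using automorphism_exists assms by blast
  have "inj_on f \<Lambda>" "f ` \<Lambda> \<subseteq> pverts G"
    using f(1) assms by (auto simp: bij_betw_def intro: inj_on_subset)
  have "(\<Sum>v\<in>\<Lambda>. conn_prob \<Lambda> w v) \<le> (\<Sum>v\<in>\<Lambda>. conn_prob (f ` \<Lambda>) root (f v))"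
    using conn_prob_automorphism[OF f(1,3) assms(1,2), of w] f(2) by (intro sum_mono) auto
  also have "\<dots> = (\<Sum>v\<in>f ` \<Lambda>. conn_prob (f ` \<Lambda>) root v)"
    using \<open>inj_on f \<Lambda>\<close> by (simp add: sum.reindex)
  finally have "ennreal (\<Sum>v\<in>\<Lambda>. conn_prob \<Lambda> w v) \<le> ennreal (\<Sum>v\<in>f ` \<Lambda>. conn_prob (f ` \<Lambda>) root v)"
    by (rule ennreal_leI)
  also have "\<dots> \<le> chi"
    using assms \<open>f ` \<Lambda> \<subseteq> pverts G\<close> by (intro sum_conn_prob_root_le) auto
  finally show ?thesis .
qed

section \<open>Exhaustion by finite volumes\<close>

lemma cluster_subset_UN_linked:
  assumes "incseq \<Lambda>" "(\<Union>m. \<Lambda> m) = pverts G" "y \<in> cluster root \<omega>"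
  shows "\<exists>m. y \<in> \<Lambda> m \<and> linked (edges \<omega>) (\<Lambda> m) root y"
  using assms(3) unfolding cluster_def mem_Collect_eq
proof (induction rule: rtrancl_induct)
  case base
  then show ?case using assms(2) root_in_verts by auto
next
  case (step y z)
  then obtain m where m: "y \<in> \<Lambda> m" "linked (edges \<omega>) (\<Lambda> m) root y" by blast
  have "z \<in> pverts G" using step(2) by (auto simp: edges_def dest: arcs_in_verts)
  then obtain k where "z \<in> \<Lambda> k" using assms(2) by blast
  moreover have "\<Lambda> m \<subseteq> \<Lambda> (max m k)" "\<Lambda> k \<subseteq> \<Lambda> (max m k)"
    using assms(1) by (simp_all add: incseqD)
  ultimately have "linked (edges \<omega>) (\<Lambda> (max m k)) root z"
    using m step(2) by (intro linked_step[OF linked_mono[OF m(2)]]) auto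
  then show ?case using \<open>z \<in> \<Lambda> k\<close> \<open>\<Lambda> k \<subseteq> \<Lambda> (max m k)\<close> by blast
qed

text \<open>Any \<open>n\<close> points of the cluster, finite or infinite, are connected to the
  root within one finite volume. The event thus lies in an increasing union of local events, and
  continuity from below transfers the bound.\<close>

lemma measure_cluster_ge_le:
  assumes "\<And>\<Lambda>. finite \<Lambda> \<Longrightarrow> \<Lambda> \<subseteq> pverts G \<Longrightarrow> root \<in> \<Lambda>
    \<Longrightarrow> prob_on \<Lambda> {\<omega>. n \<le> card {y \<in> \<Lambda>. linked (edges \<omega>) \<Lambda> root y}} \<le> b"
  shows "measure (perc G d p) {\<omega> \<in> space (perc G d p). num (cluster root \<omega>) \<ge> of_nat n} \<le> b"
proof -
  interpret P: prob_space "perc G d p" by (rule prob_space_perc)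
  define \<Lambda> where "\<Lambda> m = insert root (from_nat_into (pverts G) ` {..m})" for m
  have range: "range (from_nat_into (pverts G)) = pverts G"
    using infinite_verts countable_verts by (intro range_from_nat_into) auto
  have inc: "incseq \<Lambda>" by (auto simp: incseq_def \<Lambda>_def)
  have fin: "finite (\<Lambda> m)" and sub: "\<Lambda> m \<subseteq> pverts G" and root: "root \<in> \<Lambda> m" for m
    using range root_in_verts by (auto simp: \<Lambda>_def)
  have "pverts G \<subseteq> (\<Union>m. \<Lambda> m)"
  proof
    fix x assume "x \<in> pverts G"
    then obtain m where "x = from_nat_into (pverts G) m" using range by (metis imageE)
    then have "x \<in> \<Lambda> m" by (simp add: \<Lambda>_def)
    then show "x \<in> (\<Union>m. \<Lambda> m)" by blast
  qed
  then have UN: "(\<Union>m. \<Lambda> m) = pverts G" using sub by blast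
  let ?B = "\<lambda>m. {\<omega>. n \<le> card {y \<in> \<Lambda> m. linked (edges \<omega>) (\<Lambda> m) root y}}"
  let ?A = "\<lambda>m. {\<omega> \<in> space (perc G d p). \<omega> \<in> ?B m}"
  have loc: "\<eta> \<in> ?B m" if "\<And>x. x \<in> \<Lambda> m \<Longrightarrow> \<omega> x = \<eta> x" "\<omega> \<in> ?B m" for \<omega> \<eta> m
    using that linked_edges_cong[of "\<Lambda> m" \<omega> \<eta>] by auto
  have A: "?A m \<in> sets (perc G d p)" "P.prob (?A m) = prob_on (\<Lambda> m) (?B m)" for m
    by (rule perc_local_event[OF fin sub loc]; assumption)+
  have "incseq ?A"
  proof (rule incseq_SucI, rule subsetI)
    fix m \<omega> assume \<omega>: "\<omega> \<in> ?A m"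
    have "\<Lambda> m \<subseteq> \<Lambda> (Suc m)" using inc by (simp add: incseqD)
    then have "{y \<in> \<Lambda> m. linked (edges \<omega>) (\<Lambda> m) root y}
        \<subseteq> {y \<in> \<Lambda> (Suc m). linked (edges \<omega>) (\<Lambda> (Suc m)) root y}"
      by (auto intro: linked_mono)
    then have "card {y \<in> \<Lambda> m. linked (edges \<omega>) (\<Lambda> m) root y}
        \<le> card {y \<in> \<Lambda> (Suc m). linked (edges \<omega>) (\<Lambda> (Suc m)) root y}"
      using fin by (intro card_mono) auto
    then show "\<omega> \<in> ?A (Suc m)" using \<omega> by auto
  qed
  then have "(\<lambda>m. P.prob (?A m)) \<longlonglongrightarrow> P.prob (\<Union>m. ?A m)"
    using A(1) by (intro P.finite_Lim_measure_incseq) auto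
  then have "P.prob (\<Union>m. ?A m) \<le> b"
    by (rule LIMSEQ_le_const2) (use assms[OF fin sub root] A(2) in auto)
  moreover have "{\<omega> \<in> space (perc G d p). num (cluster root \<omega>) \<ge> of_nat n} \<subseteq> (\<Union>m. ?A m)"
  proof
    fix \<omega> assume \<omega>: "\<omega> \<in> {\<omega> \<in> space (perc G d p). num (cluster root \<omega>) \<ge> of_nat n}"
    have "\<exists>F\<subseteq>cluster root \<omega>. finite F \<and> card F = n"
    proof (cases "finite (cluster root \<omega>)")
      case True
      then have "n \<le> card (cluster root \<omega>)" using \<omega> by simp
      then show ?thesis using True by (metis obtain_subset_with_card_n)
    next
      case False
      then show ?thesis by (metis infinite_arbitrarily_large)
    qed
    then obtain F where F: "F \<subseteq> cluster root \<omega>" "finite F" "card F = n" by blast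
    have "\<forall>y\<in>F. \<exists>m. y \<in> \<Lambda> m \<and> linked (edges \<omega>) (\<Lambda> m) root y"
      using F cluster_subset_UN_linked[OF inc UN] by blast
    then obtain m where m: "\<And>y. y \<in> F \<Longrightarrow> y \<in> \<Lambda> (m y) \<and> linked (edges \<omega>) (\<Lambda> (m y)) root y" by metis
    define k where "k = Max (insert 0 (m ` F))"
    have "\<Lambda> (m y) \<subseteq> \<Lambda> k" if "y \<in> F" for y
      using that F(2) by (intro incseqD[OF inc]) (simp add: k_def)
    then have "F \<subseteq> {y \<in> \<Lambda> k. linked (edges \<omega>) (\<Lambda> k) root y}"
      using m by (blast intro: linked_mono)
    then have "n \<le> card {y \<in> \<Lambda> k. linked (edges \<omega>) (\<Lambda> k) root y}"
      unfolding F(3)[symmetric] using fin by (intro card_mono) auto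
    then show "\<omega> \<in> (\<Union>m. ?A m)" using \<omega> by blast
  qed
  then have "P.prob {\<omega> \<in> space (perc G d p). num (cluster root \<omega>) \<ge> of_nat n} \<le> P.prob (\<Union>m. ?A m)"
    using A(1) by (intro P.finite_measure_mono) auto
  ultimately show ?thesis by simp
qed

end

section \<open>The tail of the cluster size\<close>

context regular_percolation
begin

lemma two_neighbours:
  assumes "x \<in> pverts G"
  obtains y z where "y \<in> nbrs G x" "z \<in> nbrs G x" "y \<noteq> z"
proof -
  have "\<not> card (nbrs G x) \<le> Suc 0" using assms degree_ge_2 by simp
  then show thesis using that assms card_le_Suc0_iff_eq[of "nbrs G x"] by auto
qed

lemma weak_c_bounds: "0 \<le> weak_c p d" "weak_c p d \<le> 1"
proof -
  obtain y where "y \<in> nbrs G root" using two_neighbours root_in_verts by metis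
  then have "weak_c p d = measure_pmf.prob (state root) {S. y \<in> S}"
    using root_in_verts by (simp add: prob_state_member)
  then show "0 \<le> weak_c p d" "weak_c p d \<le> 1" by simp_all
qed

lemma strong_c2_bounds: "0 \<le> strong_c2 p d" "strong_c2 p d \<le> weak_c p d"
proof -
  obtain y z where yz: "y \<in> nbrs G root" "z \<in> nbrs G root" "y \<noteq> z"
    using two_neighbours root_in_verts by metis
  then have *: "strong_c2 p d = measure_pmf.prob (state root) {S. y \<in> S \<and> z \<in> S}"
    using root_in_verts by (simp add: prob_state_two_members)
  have "\<dots> \<le> measure_pmf.prob (state root) {S. y \<in> S}"
    by (intro measure_pmf.finite_measure_mono) auto
  then show "strong_c2 p d \<le> weak_c p d"
    using * yz root_in_verts by (simp add: prob_state_member)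
  show "0 \<le> strong_c2 p d" by (simp add: *)
qed

lemma strong_c_eq: "strong_c p d = weak_c p d * strong_c2 p d / (real d)\<^sup>2"
  by (simp add: strong_c_def weak_c_def strong_c2_def)

abbreviation reach_in :: "'v set \<Rightarrow> 'v \<Rightarrow> 'v \<Rightarrow> ('v \<Rightarrow> 'v set) set" where
  "reach_in \<Lambda> \<equiv> finite_percolation.reach \<Lambda> (parcs G) edges"

lemma reach_in_def:
  assumes "finite \<Lambda>"
  shows "reach_in \<Lambda> w v
    = {\<omega>. w = v \<or> (\<exists>w'. (w, w') \<in> parcs G \<and> linked (edges \<omega>) (\<Lambda> - {w}) w' v)}"
  by (rule finite_percolation.reach_def[OF finite_percolation_edges[OF assms]])

lemma linked_upd_off:
  "w \<notin> K \<Longrightarrow> linked (edges (fun_upd \<omega> w s)) K x y \<longleftrightarrow> linked (edges \<omega>) K x y"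
  by (rule linked_edges_cong) auto

text \<open>The state of \<open>w\<close> is independent of the off-\<open>w\<close> part of the path and opens its first step.\<close>

lemma weak_reach_le:
  assumes op: "op = (\<or>)" and \<Lambda>: "finite \<Lambda>" "\<Lambda> \<subseteq> pverts G" "w \<in> \<Lambda>" "v \<in> \<Lambda>"
  shows "weak_c p d * prob_on \<Lambda> (reach_in \<Lambda> w v) \<le> conn_prob \<Lambda> w v"
proof (rule prob_resample[OF \<Lambda>(1,3) weak_c_bounds(1)])
  fix \<omega> assume "\<omega> \<in> reach_in \<Lambda> w v"
  then consider "w = v" | w' where "(w, w') \<in> parcs G" "linked (edges \<omega>) (\<Lambda> - {w}) w' v"
    using \<Lambda>(1) by (auto simp: reach_in_def)
  then show "weak_c p d \<le> measure_pmf.prob (state w) {s. fun_upd \<omega> w s \<in> {\<omega>. linked (edges \<omega>) \<Lambda> w v}}"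
  proof cases
    case 1
    then show ?thesis using weak_c_bounds(2) by simp
  next
    case 2
    have w': "w' \<in> \<Lambda>" "w \<in> pverts G" using linked_eq_or_mem[OF 2(2)] \<Lambda> by auto
    have "linked (edges (fun_upd \<omega> w s)) \<Lambda> w v" if "w' \<in> s" for s
    proof (rule linked_first)
      have "op True b" for b using op by simp
      then show "(w, w') \<in> edges (fun_upd \<omega> w s)" using 2 that by (simp add: edges_def)
      have "linked (edges (fun_upd \<omega> w s)) (\<Lambda> - {w}) w' v" using 2 by (simp add: linked_upd_off)
      then show "linked (edges (fun_upd \<omega> w s)) \<Lambda> w' v" by (rule linked_mono) auto
    qed (use w' \<Lambda> in auto)
    then have "measure_pmf.prob (state w) {s. w' \<in> s}
        \<le> measure_pmf.prob (state w) {s. fun_upd \<omega> w s \<in> {\<omega>. linked (edges \<omega>) \<Lambda> w v}}"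
      by (intro measure_pmf.finite_measure_mono) auto
    with 2 w' show ?thesis by (simp add: prob_state_member)
  qed
qed

text \<open>
  In the strong case the second vertex \<open>w'\<close> of the path is resampled as well, so the remaining path
  has to avoid both \<open>w\<close> and \<open>w'\<close>, at the cost of summing over the choices of \<open>w'\<close>.
\<close>

lemma strong_reach_le:
  assumes op: "op = (\<and>)" and \<Lambda>: "finite \<Lambda>" "\<Lambda> \<subseteq> pverts G" "w \<in> \<Lambda>" "v \<in> \<Lambda>"
  shows "strong_c p d * prob_on \<Lambda> (reach_in \<Lambda> w v) \<le> conn_prob \<Lambda> w v"
proof -
  let ?c = "weak_c p d" and ?c2 = "strong_c2 p d"
  have c: "0 \<le> ?c" "?c \<le> 1" "0 \<le> ?c2" "?c2 \<le> ?c"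
    using weak_c_bounds strong_c2_bounds by auto
  have w: "w \<in> pverts G" using \<Lambda> by blast
  have op_iff: "op a b \<longleftrightarrow> a \<and> b" for a b using op by simp
  \<comment> \<open>The adjacent case needs \<open>?c * ?c\<close> and the general one
    \<open>?c * ?c2 / real d\<close>; both dominate \<open>strong_c p d\<close>, which carries the
    factor 1/d^2.\<close>
  have "strong_c p d \<le> ?c * ?c2 / 1" "strong_c p d \<le> ?c * ?c2 / real d"
  proof -
    have "1 \<le> real d * real d" "real d \<le> real d * real d" "0 < real d"
      using degree_ge_2 mult_mono[of 1 "real d" 1 "real d"] by auto
    then show "strong_c p d \<le> ?c * ?c2 / 1" "strong_c p d \<le> ?c * ?c2 / real d"
      unfolding strong_c_eq power2_eq_square using c
      by (intro divide_left_mono mult_nonneg_nonneg; simp)+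
  qed
  moreover have "?c * ?c2 \<le> ?c * ?c" "?c * ?c \<le> 1" "0 \<le> strong_c p d"
    using c by (auto intro: mult_left_mono mult_le_one simp: strong_c_eq)
  ultimately have sc: "strong_c p d \<le> ?c * ?c" "strong_c p d \<le> 1"
    "strong_c p d \<le> ?c * ?c2 / real d" "0 \<le> strong_c p d"
    by auto
  consider "w = v" | "(w, v) \<in> parcs G" | "w \<noteq> v" "(w, v) \<notin> parcs G" by blast
  then show ?thesis
  proof cases
    case 1
    then show ?thesis using sc by (simp add: mult_le_one)
  next
    \<comment> \<open>For neighbours the probability of \<open>reach_in\<close> is bounded by 1, and
      the single edge is opened by resampling both ends, each at cost \<open>?c\<close>.\<close>
    case 2
    have "?c * prob_on \<Lambda> UNIV \<le> prob_on \<Lambda> {\<omega>. v \<in> \<omega> w}"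
      using 2 w by (intro prob_resample[OF \<Lambda>(1,3)] c) (simp add: prob_state_member)
    moreover have "?c * prob_on \<Lambda> {\<omega>. v \<in> \<omega> w} \<le> conn_prob \<Lambda> w v"
    proof (rule prob_resample[OF \<Lambda>(1,4) c(1)])
      fix \<omega> assume \<omega>: "\<omega> \<in> {\<omega>. v \<in> \<omega> w}"
      have "linked (edges (fun_upd \<omega> v s)) \<Lambda> w v" if "w \<in> s" for s
        using that \<omega> 2 \<Lambda> arcs_loopfree[OF 2] by (intro linked_first[of w v]) (auto simp: edges_def op_iff)
      then have "measure_pmf.prob (state v) {s. w \<in> s}
          \<le> measure_pmf.prob (state v) {s. fun_upd \<omega> v s \<in> {\<omega>. linked (edges \<omega>) \<Lambda> w v}}"
        by (intro measure_pmf.finite_measure_mono) auto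
      then show "?c \<le> measure_pmf.prob (state v) {s. fun_upd \<omega> v s \<in> {\<omega>. linked (edges \<omega>) \<Lambda> w v}}"
        using 2 arcs_sym[OF 2] arcs_in_verts[OF 2] by (simp add: prob_state_member)
    qed
    ultimately have "?c * ?c \<le> conn_prob \<Lambda> w v"
      using c(1) mult_left_mono[of ?c "prob_on \<Lambda> {\<omega>. v \<in> \<omega> w}" ?c] by simp
    moreover have "strong_c p d * prob_on \<Lambda> (reach_in \<Lambda> w v) \<le> strong_c p d"
      using sc by (intro mult_left_le) auto
    ultimately show ?thesis using sc by simp
  next
    case 3
    \<comment> \<open>\<open>D w'\<close> keeps only what survives a change of the states of
      \<open>w\<close> and \<open>w'\<close>: a path from \<open>u\<close> avoiding both, and the
      direction of the edge at \<open>w'\<close> that is stored in the state of \<open>u\<close>.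
      Putting \<open>w'\<close> into the state of \<open>w\<close>, then \<open>w\<close> and
      \<open>u\<close> into that of \<open>w'\<close>, restores the connection at cost
      \<open>?c * ?c2\<close>.\<close>
    define D where "D w' = {\<omega>. \<exists>u. (w', u) \<in> parcs G \<and> w' \<in> \<omega> u \<and> u \<in> \<Lambda> - {w, w'}
      \<and> linked (edges \<omega>) (\<Lambda> - {w, w'}) u v}" for w'
    let ?N = "nbrs G w \<inter> \<Lambda>"
    have "reach_in \<Lambda> w v \<subseteq> (\<Union>w'\<in>?N. D w')"
    proof
      fix \<omega> assume "\<omega> \<in> reach_in \<Lambda> w v"
      then obtain w' where w': "(w, w') \<in> parcs G" "linked (edges \<omega>) (\<Lambda> - {w}) w' v"
        using \<Lambda>(1) 3 by (auto simp: reach_in_def)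
      have ne: "v \<noteq> w'" using w' 3 by auto
      then have "w' \<in> \<Lambda> - {w}" using linked_eq_or_mem[OF w'(2)] by auto
      then have "\<Lambda> - {w} = insert w' (\<Lambda> - {w, w'})" by auto
      with w'(2) have "linked (edges \<omega>) (insert w' (\<Lambda> - {w, w'})) w' v" by simp
      then obtain u where "(w', u) \<in> edges \<omega>" "u \<in> \<Lambda> - {w, w'}" "linked (edges \<omega>) (\<Lambda> - {w, w'}) u v"
        using ne by (rule linked_last_exit) auto
      then have "\<omega> \<in> D w'" by (auto simp: D_def edges_def op_iff)
      with w' \<open>w' \<in> \<Lambda> - {w}\<close> show "\<omega> \<in> (\<Union>w'\<in>?N. D w')" by blast
    qed
    then have "prob_on \<Lambda> (reach_in \<Lambda> w v) \<le> prob_on \<Lambda> (\<Union>w'\<in>?N. D w')"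
      by (intro measure_pmf.finite_measure_mono) auto
    also have "\<dots> \<le> (\<Sum>w'\<in>?N. prob_on \<Lambda> (D w'))"
      using \<Lambda>(1) by (intro measure_UNION_le) auto
    finally have reach: "prob_on \<Lambda> (reach_in \<Lambda> w v) \<le> (\<Sum>w'\<in>?N. prob_on \<Lambda> (D w'))" .
    have D: "?c * ?c2 * prob_on \<Lambda> (D w') \<le> conn_prob \<Lambda> w v" if "w' \<in> ?N" for w'
    proof -
      have arc: "(w, w') \<in> parcs G" "(w', w) \<in> parcs G" "w' \<in> \<Lambda>" "w' \<in> pverts G" "w \<noteq> w'"
        using that arcs_sym \<Lambda>(2) arcs_loopfree by auto
      have "?c * prob_on \<Lambda> (D w') \<le> prob_on \<Lambda> (D w' \<inter> {\<omega>. w' \<in> \<omega> w})"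
      proof (rule prob_resample[OF \<Lambda>(1,3) c(1)])
        fix \<omega> assume "\<omega> \<in> D w'"
        then obtain u where "(w', u) \<in> parcs G" "w' \<in> \<omega> u" "u \<in> \<Lambda> - {w, w'}"
          "linked (edges \<omega>) (\<Lambda> - {w, w'}) u v" by (auto simp: D_def)
        then have "fun_upd \<omega> w s \<in> D w'" for s
          unfolding D_def by (auto simp: linked_upd_off intro!: exI[of _ u])
        then have "{s. fun_upd \<omega> w s \<in> D w' \<inter> {\<omega>. w' \<in> \<omega> w}} = {s. w' \<in> s}" by auto
        then show "?c \<le> measure_pmf.prob (state w) {s. fun_upd \<omega> w s \<in> D w' \<inter> {\<omega>. w' \<in> \<omega> w}}"
          using arc w by (simp add: prob_state_member)
      qed
      moreover have "?c2 * prob_on \<Lambda> (D w' \<inter> {\<omega>. w' \<in> \<omega> w}) \<le> conn_prob \<Lambda> w v"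
      proof (rule prob_resample[OF \<Lambda>(1) arc(3) c(3)])
        fix \<omega> assume \<omega>: "\<omega> \<in> D w' \<inter> {\<omega>. w' \<in> \<omega> w}"
        then obtain u where u: "(w', u) \<in> parcs G" "u \<in> \<Lambda> - {w, w'}"
          "linked (edges \<omega>) (\<Lambda> - {w, w'}) u v" "w' \<in> \<omega> w" "w' \<in> \<omega> u" by (auto simp: D_def)
        show "?c2 \<le> measure_pmf.prob (state w') {s. fun_upd \<omega> w' s \<in> {\<omega>. linked (edges \<omega>) \<Lambda> w v}}"
        proof -
          have "linked (edges (fun_upd \<omega> w' s)) \<Lambda> w v" if s: "w \<in> s" "u \<in> s" for s
          proof -
            have "linked (edges (fun_upd \<omega> w' s)) (\<Lambda> - {w, w'}) u v"
              using u(3) by (simp add: linked_upd_off)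
            then have "linked (edges (fun_upd \<omega> w' s)) \<Lambda> u v" by (rule linked_mono) auto
            moreover have "(w', u) \<in> edges (fun_upd \<omega> w' s)"
              using s u by (auto simp: edges_def op_iff)
            moreover have "(w, w') \<in> edges (fun_upd \<omega> w' s)"
              using s u arc by (simp add: edges_def op_iff)
            ultimately show ?thesis
              using u(2) arc(3) \<Lambda>(3) linked_first by (metis DiffD1)
          qed
          then have "measure_pmf.prob (state w') {s. w \<in> s \<and> u \<in> s}
              \<le> measure_pmf.prob (state w') {s. fun_upd \<omega> w' s \<in> {\<omega>. linked (edges \<omega>) \<Lambda> w v}}"
            by (intro measure_pmf.finite_measure_mono) auto
          moreover have "measure_pmf.prob (state w') {s. w \<in> s \<and> u \<in> s} = ?c2"
            using arc u by (intro prob_state_two_members) auto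
          ultimately show ?thesis by simp
        qed
      qed
      ultimately show ?thesis
        using c mult_left_mono[of "?c * prob_on \<Lambda> (D w')" "prob_on \<Lambda> (D w' \<inter> {\<omega>. w' \<in> \<omega> w})" ?c2]
        by (simp add: mult_ac)
    qed
    have "card ?N \<le> d" using w regular[OF w] card_mono[of "nbrs G w" ?N] by auto
    have "?c * ?c2 * (\<Sum>w'\<in>?N. prob_on \<Lambda> (D w')) = (\<Sum>w'\<in>?N. ?c * ?c2 * prob_on \<Lambda> (D w'))"
      by (simp add: sum_distrib_left)
    also have "\<dots> \<le> real (card ?N) * conn_prob \<Lambda> w v"
      using D by (intro sum_bounded_above) auto
    also have "\<dots> \<le> real d * conn_prob \<Lambda> w v"
      using \<open>card ?N \<le> d\<close> by (intro mult_right_mono) auto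
    finally have "?c * ?c2 / real d * (\<Sum>w'\<in>?N. prob_on \<Lambda> (D w')) \<le> conn_prob \<Lambda> w v"
      using degree_ge_2 by (simp add: field_simps)
    moreover have "strong_c p d * prob_on \<Lambda> (reach_in \<Lambda> w v)
        \<le> ?c * ?c2 / real d * (\<Sum>w'\<in>?N. prob_on \<Lambda> (D w'))"
      using sc reach c by (intro mult_mono) auto
    ultimately show ?thesis by linarith
  qed
qed

section \<open>From moments to the exponential bound\<close>

lemma cluster_tail:
  assumes c: "c > 0" and reach: "\<And>\<Lambda> w v. finite \<Lambda> \<Longrightarrow> \<Lambda> \<subseteq> pverts G \<Longrightarrow> w \<in> \<Lambda> \<Longrightarrow> v \<in> \<Lambda>
      \<Longrightarrow> c * prob_on \<Lambda> (reach_in \<Lambda> w v) \<le> conn_prob \<Lambda> w v"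
    and X: "chi = ennreal X" "3 * c \<le> X" and n: "real n > X\<^sup>2 / c\<^sup>2"
  shows "measure (perc G d p) {\<omega> \<in> space (perc G d p). num (cluster root \<omega>) \<ge> of_nat n}
    \<le> exp (- (real n * (c\<^sup>2 / (2 * X\<^sup>2))))"
proof (rule measure_cluster_ge_le)
  fix \<Lambda> assume \<Lambda>: "finite \<Lambda>" "\<Lambda> \<subseteq> pverts G" "root \<in> \<Lambda>"
  interpret L: finite_percolation \<Lambda> "parcs G" edges "{}" state
    using \<Lambda>(1) by (rule finite_percolation_edges)
  define B where "B = X / c"
  define t where "t = real n / (2 * B\<^sup>2)"
  define P where "P = prob_on \<Lambda> {\<omega>. n \<le> card {y \<in> \<Lambda>. linked (edges \<omega>) \<Lambda> root y}}"
  have B3: "B \<ge> 3" using c X(2) by (simp add: B_def field_simps)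
  \<comment> \<open>The hypothesis on \<open>n\<close> reads n > B^2, that is t > 1/2. Hence exp t
    \<ge> 3/2, and exp t \<le> 3 (exp t - 1) \<le> B (exp t - 1), which absorbs the prefactor and
    the subtracted 1.\<close>
  have "t > 1 / 2"
    using n c B3 by (simp add: t_def B_def power_divide field_simps)
  then have e: "exp t \<ge> 3 / 2" using exp_ge_add_one_self[of t] by linarith
  have "(\<Sum>v\<in>\<Lambda>. prob_on \<Lambda> (reach_in \<Lambda> w v)) \<le> B" if w: "w \<in> \<Lambda>" for w
  proof -
    have "c * (\<Sum>v\<in>\<Lambda>. prob_on \<Lambda> (reach_in \<Lambda> w v)) \<le> (\<Sum>v\<in>\<Lambda>. conn_prob \<Lambda> w v)"
      unfolding sum_distrib_left using \<Lambda> w by (intro sum_mono reach) auto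
    also have "\<dots> \<le> X"
      using sum_conn_prob_le[OF \<Lambda>(1,2) w] X c by (simp add: X(1) sum_nonneg)
    finally show ?thesis using c by (simp add: B_def field_simps)
  qed
  then have tail: "(exp t - 1) * P \<le> 1 / B"
    unfolding t_def P_def using B3 \<Lambda>(3) by (intro L.cluster_tail_bound) auto
  have "1 / B \<le> 1 / 3" using B3 by (intro divide_left_mono) auto
  with tail have "3 * ((exp t - 1) * P) \<le> 1" by linarith
  moreover have "exp t * P \<le> (3 * (exp t - 1)) * P"
    using e by (intro mult_right_mono) (auto simp: P_def)
  ultimately have "exp t * P \<le> 1" by (simp only: mult.assoc)
  then have "P \<le> exp (- t)" by (simp add: exp_minus field_simps)
  then show "P \<le> exp (- (real n * (c\<^sup>2 / (2 * X\<^sup>2))))"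
    by (simp add: t_def B_def power_divide)
qed

lemma chi_ge_1: "1 \<le> chi"
  using sum_conn_prob_le[of "{root}" root] root_in_verts by simp

text \<open>The volume of the root and two of its neighbours suffices: there \<open>reach_in\<close>
  from the root to a neighbour is the sure event, so each neighbour is connected with probability at
  least \<open>weak_c p d\<close>.\<close>

lemma weak_chi_ge:
  assumes op: "op = (\<or>)"
  shows "ennreal (1 + 2 * weak_c p d) \<le> chi"
proof -
  obtain y z where yz: "y \<in> nbrs G root" "z \<in> nbrs G root" "y \<noteq> z"
    using two_neighbours root_in_verts by metis
  let ?\<Lambda> = "{root, y, z}"
  have ne: "root \<noteq> y" "root \<noteq> z" using yz arcs_loopfree by auto
  have V: "?\<Lambda> \<subseteq> pverts G" using yz root_in_verts by (auto dest: arcs_in_verts)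
  have le: "weak_c p d \<le> conn_prob ?\<Lambda> root v" if "v \<in> {y, z}" for v
  proof -
    have "reach_in ?\<Lambda> root v = UNIV" using that yz by (auto simp: reach_in_def)
    then show ?thesis using weak_reach_le[OF op _ V, of root v] that by auto
  qed
  have "1 + 2 * weak_c p d \<le> (\<Sum>v\<in>?\<Lambda>. conn_prob ?\<Lambda> root v)"
    using le[of y] le[of z] ne yz(3) by simp
  then show ?thesis
    using sum_conn_prob_le[of ?\<Lambda> root] V by (meson ennreal_leI finite.intros insertI1 order_trans)
qed

lemma strong_c_bounds: "0 \<le> strong_c p d" "strong_c p d \<le> 1 / 4"
proof -
  have "weak_c p d * strong_c2 p d \<le> 1"
    using weak_c_bounds strong_c2_bounds by (intro mult_le_one) auto
  moreover have "4 \<le> (real d)\<^sup>2"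
    using power_mono[of 2 "real d" 2] degree_ge_2 by simp
  moreover have "0 < (real d)\<^sup>2" using degree_ge_2 by simp
  ultimately show "strong_c p d \<le> 1 / 4"
    unfolding strong_c_eq by (subst pos_divide_le_eq) simp_all
  show "0 \<le> strong_c p d"
    using weak_c_bounds strong_c2_bounds by (simp add: strong_c_eq)
qed

lemma cluster_tail_ennreal:
  assumes "c \<ge> 0" and reach: "\<And>\<Lambda> w v. finite \<Lambda> \<Longrightarrow> \<Lambda> \<subseteq> pverts G \<Longrightarrow> w \<in> \<Lambda> \<Longrightarrow> v \<in> \<Lambda>
      \<Longrightarrow> c * prob_on \<Lambda> (reach_in \<Lambda> w v) \<le> conn_prob \<Lambda> w v"
    and chi: "chi < \<infinity>" "ennreal (3 * c) \<le> chi" and n: "of_nat n > chi\<^sup>2 / ennreal (c\<^sup>2)"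
  shows "measure (perc G d p) {\<omega> \<in> space (perc G d p). num (cluster root \<omega>) \<ge> of_nat n}
    \<le> exp (- (real n * (c\<^sup>2 / (2 * (enn2real chi)\<^sup>2))))"
proof -
  obtain X where X: "X \<ge> 0" "chi = ennreal X"
    using chi(1) by (cases chi) auto
  have "X \<ge> 1" using chi_ge_1 X by simp
  \<comment> \<open>For \<open>c = 0\<close> the quotient is infinite, because \<open>chi\<close> is
    at least 1 and the case 0/0 cannot occur; no \<open>n\<close> exceeds it.\<close>
  have "c \<noteq> 0"
  proof
    assume "c = 0"
    then have "chi\<^sup>2 / ennreal (c\<^sup>2) = \<infinity>"
      using \<open>X \<ge> 1\<close> X by (simp add: ennreal_power ennreal_divide_zero)
    with n show False by simp
  qed
  then have "c > 0" using assms(1) by simp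
  moreover have "X\<^sup>2 / c\<^sup>2 < real n"
  proof -
    have "chi\<^sup>2 / ennreal (c\<^sup>2) = ennreal (X\<^sup>2 / c\<^sup>2)"
      using X \<open>c > 0\<close> by (simp add: ennreal_power divide_ennreal)
    with n show ?thesis by (simp add: ennreal_of_nat_eq_real_of_nat ennreal_less_iff)
  qed
  moreover have "3 * c \<le> X" using chi(2) X by simp
  ultimately show ?thesis
    using cluster_tail[OF _ reach X(2), of n] X by simp
qed

section \<open>Weak and strong clusters as instances\<close>

lemma rtrancl_in_verts:
  "(x, y) \<in> (edges \<omega>)\<^sup>* \<Longrightarrow> x \<in> pverts G \<Longrightarrow> y \<in> pverts G"
  by (induction rule: rtrancl_induct) (auto simp: edges_def dest: arcs_in_verts)

lemma open_arcs_iff: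
  assumes "\<omega> \<in> space (perc G d p)"
  shows "(x, y) \<in> open_arcs G \<omega> \<longleftrightarrow> (x, y) \<in> parcs G \<and> y \<in> \<omega> x"
  using assms by (auto simp: open_arcs_def space_perc dest: arcs_in_verts)

lemma weak_cluster_eq:
  assumes "op = (\<or>)" "\<omega> \<in> space (perc G d p)" "x \<in> pverts G"
  shows "weak_cluster G x \<omega> = cluster x \<omega>"
proof -
  have "op a b \<longleftrightarrow> a \<or> b" for a b using assms(1) by simp
  then have "(a, b) \<in> edges \<omega> \<longleftrightarrow> (a, b) \<in> open_arcs G \<omega> \<union> (open_arcs G \<omega>)\<inverse>" for a b
    using arcs_sym[of a b] arcs_sym[of b a] by (auto simp: edges_def open_arcs_iff[OF assms(2)])
  then have "edges \<omega> = open_arcs G \<omega> \<union> (open_arcs G \<omega>)\<inverse>" by auto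
  then show ?thesis
    using rtrancl_in_verts[of x _ \<omega>] assms(3) by (auto simp: weak_cluster_def cluster_def)
qed

lemma strong_cluster_eq:
  assumes "op = (\<and>)" "\<omega> \<in> space (perc G d p)" "x \<in> pverts G"
  shows "strong_cluster G x \<omega> = cluster x \<omega>"
proof -
  have "op a b \<longleftrightarrow> a \<and> b" for a b using assms(1) by simp
  then have "(a, b) \<in> edges \<omega> \<longleftrightarrow> (a, b) \<in> open_arcs G \<omega> \<inter> (open_arcs G \<omega>)\<inverse>" for a b
    using arcs_sym[of a b] arcs_sym[of b a] by (auto simp: edges_def open_arcs_iff[OF assms(2)])
  then have "edges \<omega> = open_arcs G \<omega> \<inter> (open_arcs G \<omega>)\<inverse>" by auto
  then show ?thesis
    using rtrancl_in_verts[of x _ \<omega>] assms(3) by (auto simp: strong_cluster_def cluster_def)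
qed

lemma weak_tail:
  assumes op: "op = (\<or>)" and chi: "weak_chi G root d p < \<infinity>"
    and n: "of_nat n > (weak_chi G root d p)\<^sup>2 / ennreal ((weak_c p d)\<^sup>2)"
  shows "measure (perc G d p) {\<omega> \<in> space (perc G d p). num (weak_cluster G root \<omega>) \<ge> of_nat n}
    \<le> exp (- (real n * ((weak_c p d)\<^sup>2 / (2 * (enn2real (weak_chi G root d p))\<^sup>2))))"
proof -
  have eq: "weak_chi G root d p = chi"
    unfolding weak_chi_def chi_def using weak_cluster_eq[OF op _ root_in_verts]
    by (intro nn_integral_cong) simp
  have set: "{\<omega> \<in> space (perc G d p). num (weak_cluster G root \<omega>) \<ge> of_nat n}
      = {\<omega> \<in> space (perc G d p). num (cluster root \<omega>) \<ge> of_nat n}"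
    using weak_cluster_eq[OF op _ root_in_verts] by auto
  have "ennreal (3 * weak_c p d) \<le> ennreal (1 + 2 * weak_c p d)"
    using weak_c_bounds by (intro ennreal_leI) simp
  then have "ennreal (3 * weak_c p d) \<le> chi" using weak_chi_ge[OF op] by (rule order_trans)
  then show ?thesis
    using chi n unfolding eq set
    by (intro cluster_tail_ennreal weak_c_bounds weak_reach_le[OF op])
qed

lemma strong_tail:
  assumes op: "op = (\<and>)" and chi: "strong_chi G root d p < \<infinity>"
    and n: "of_nat n > (strong_chi G root d p)\<^sup>2 / ennreal ((strong_c p d)\<^sup>2)"
  shows "measure (perc G d p) {\<omega> \<in> space (perc G d p). num (strong_cluster G root \<omega>) \<ge> of_nat n}
    \<le> exp (- (real n * ((strong_c p d)\<^sup>2 / (2 * (enn2real (strong_chi G root d p))\<^sup>2))))"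
proof -
  have eq: "strong_chi G root d p = chi"
    unfolding strong_chi_def chi_def using strong_cluster_eq[OF op _ root_in_verts]
    by (intro nn_integral_cong) simp
  have set: "{\<omega> \<in> space (perc G d p). num (strong_cluster G root \<omega>) \<ge> of_nat n}
      = {\<omega> \<in> space (perc G d p). num (cluster root \<omega>) \<ge> of_nat n}"
    using strong_cluster_eq[OF op _ root_in_verts] by auto
  have "ennreal (3 * strong_c p d) \<le> ennreal 1"
    using strong_c_bounds by (intro ennreal_leI) simp
  then have "ennreal (3 * strong_c p d) \<le> chi" using chi_ge_1 by (metis ennreal_1 order_trans)
  then show ?thesis
    using chi n unfolding eq set
    by (intro cluster_tail_ennreal strong_c_bounds strong_reach_le[OF op])
qed

end

theorem theorem21:
  fixes G :: "'v pair_pre_digraph" and root :: 'v and d :: nat and p :: "nat \<Rightarrow> real"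
  assumes "transitive_regular_digraph G root d"
    and "\<And>i. i \<le> d \<Longrightarrow> 0 \<le> p i"
    and "(\<Sum>i\<le>d. p i) = 1"
  shows "(weak_chi G root d p < \<infinity> \<longrightarrow>
            (\<forall>n::nat. n > 0 \<longrightarrow>
               of_nat n > (weak_chi G root d p)^2 / ennreal ((weak_c p d)^2) \<longrightarrow>
               measure (perc G d p)
                 {\<omega> \<in> space (perc G d p). num (weak_cluster G root \<omega>) \<ge> of_nat n}
               \<le> exp (- (real n * ((weak_c p d)^2 / (2 * (enn2real (weak_chi G root d p))^2))))))
       \<and> (strong_chi G root d p < \<infinity> \<longrightarrow>
            (\<forall>n::nat. n > 0 \<longrightarrow>
               of_nat n > (strong_chi G root d p)^2 / ennreal ((strong_c p d)^2) \<longrightarrow>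
               measure (perc G d p)
                 {\<omega> \<in> space (perc G d p). num (strong_cluster G root \<omega>) \<ge> of_nat n}
               \<le> exp (- (real n * ((strong_c p d)^2 / (2 * (enn2real (strong_chi G root d p))^2))))))"
proof -
  interpret transitive_regular_digraph G root d by fact
  interpret weak: regular_percolation G root d p "(\<or>)"
    using assms(2,3) by unfold_locales auto
  interpret strong: regular_percolation G root d p "(\<and>)"
    using assms(2,3) by unfold_locales auto
  show ?thesis
    using weak.weak_tail[OF refl] strong.strong_tail[OF refl] by blast
qed

end
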